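(* Let $\mathbb{F}$ be a field of characteristic not two, $\eta\in\mathbb{F}$, $\eta\neq0,1$, and let $A$ be an axial algebra of Jordan type $\eta$ over $\mathbb{F}$ generated by primitive axes $a$, $b$, $c$. Put $\alpha=\varphi_a(b)$, $\beta=\varphi_b(c)$, $\gamma=\varphi_c(a)$, $\psi=\varphi_a(bc)$. Then $A$ is the linear span of $\mathcal{B}=\{a,b,c,ab,ac,bc,(ab)c,(ac)b,(bc)a\}$. Moreover, if $\eta=\frac12$, then the pairwise products of elements of $\mathcal{B}$ are given by the following table, where $\lambda_{ab}=\lambda_{ba}=\alpha$, $\lambda_{bc}=\lambda_{cb}=\beta$, $\lambda_{ac}=\lambda_{ca}=\gamma$ and the formulas hold for every permutation $(x,y,z)$ of $(a,b,c)$: (1) $x\cdot x=x$, $\ x\cdot y=xy$, $\ x\cdot yz=x(yz)$; (2) $x\cdot xy=\frac12(\lambda_{xy}x+xy)$; (3) $x\cdot x(yz)=\frac12(\psi x+x(yz))$; (4) $x\cdot y(xz)=\frac14(\psi x+\lambda_{xz}\,xy+\lambda_{xy}\,xz+x(yz)+y(xz)-z(xy))$; (5) $xy\cdot xy=\frac{\lambda_{xy}}{4}(x+y)+\frac{\lambda_{xy}}{2}xy$; (6) $xy\cdot xz=\frac14(\psi x+\lambda_{xz}\,xy+\lambda_{xy}\,xz-x(yz)+y(xz)+z(xy))$; (7) $xy\cdot x(yz)=\frac18((\lambda_{xy}\lambda_{yz}+\psi)x+\psi y+2\psi\,xy+\lambda_{xy}\,yz+2\lambda_{xy}\,x(yz))$;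 (8) $xy\cdot z(xy)=\frac18(\lambda_{xy}\lambda_{yz}x+\lambda_{xy}\lambda_{xz}y+4\psi\,xy+\lambda_{xy}\,yz+\lambda_{xy}\,xz-2\lambda_{xy}\,x(yz)-2\lambda_{xy}\,y(xz)+4\lambda_{xy}\,z(xy))$; (9) $(x(yz))^2=\frac1{16}(\lambda_{yz}(\lambda_{xy}+\lambda_{xz}+2\psi)x+\lambda_{yz}\lambda_{xz}y+\lambda_{yz}\lambda_{xy}z+4\psi\,yz+(2\lambda_{yz}+8\psi)\,x(yz)-2\lambda_{yz}\,y(xz)-2\lambda_{yz}\,z(xy))$; (10) $x(yz)\cdot y(xz)=\frac1{16}(\lambda_{yz}(\lambda_{xz}+\psi)x+\lambda_{xz}(\lambda_{yz}+\psi)y+\lambda_{xy}\psi z+2\psi\,xy+2(\lambda_{xy}\lambda_{xz}+\psi)yz+2(\lambda_{xy}\lambda_{yz}+\psi)xz+(4\psi-\lambda_{xy}+\lambda_{yz}-\lambda_{xz})x(yz)+(4\psi-\lambda_{xy}-\lambda_{yz}+\lambda_{xz})y(xz)+(\lambda_{xy}-\lambda_{yz}-\lambda_{xz}-4\psi)z(xy))$.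
   Context: Algebras are not assumed associative. For a commutative $\mathbb{F}$-algebra $A$, $a\in A$ and $\lambda\in\mathbb{F}$, let $ad_a: x\mapsto xa$ and let $A_\lambda(a)$ be the $\lambda$-eigenspace of $ad_a$ (possibly zero). Let $\eta\in\mathbb{F}\setminus\{0,1\}$. A commutative $\mathbb{F}$-algebra $A$ is an axial algebra of Jordan type $\eta$ if it is generated (as an algebra) by a set $X$ of idempotents (called axes) such that for each $a\in X$: (1) the minimal polynomial of $ad_a$ divides $(x-1)x(x-\eta)$, so $A=A_1(a)\oplus A_0(a)\oplus A_\eta(a)$; (2) $A_1(a)A_1(a)\subseteq A_1(a)$, $A_0(a)A_0(a)\subseteq A_0(a)$, $A_1(a)A_0(a)=\{0\}$, $(A_0(a)+A_1(a))A_\eta(a)\subseteq A_\eta(a)$, $A_\eta(a)A_\eta(a)\subseteq A_0(a)+A_1(a)$. An axis $a$ is primitive if $A_1(a)=\langle a\rangle$ is 1-dimensional. "Generated by primitive axes $a,b,c$" means one may take $X=\{a,b,c\}$ with all three axes primitive. For a primitive axis $a$ and $y\in A$, $\varphi_a(y)\in\mathbb{F}$ is the scalar such that the projection of $y$ on $A_1(a)$ along $A_0(a)\oplus A_\eta(a)$ equals $\varphi_a(y)a$. In the formulas, $uv\cdot w$ means the product of $uv$ with $w$, and by commutativity $xy=yx$ and $x(yz)=x(zy)=(yz)x$. *)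

theory Defs
  imports Complex_Main "HOL-Computational_Algebra.Polynomial" "HOL-Library.Set_Algebras"
begin

text \<open>The algebra is a whole type \<open>'v\<close>. The product is a separate operation and not the
  one of a type class, because the classes of the library with a distributive product also
  make it associative.\<close>

locale comm_nonassoc_algebra = vector_space scale
  for scale :: "'k::field \<Rightarrow> 'v::ab_group_add \<Rightarrow> 'v"  (infixr \<open>*\<^sub>F\<close> 76) +
  fixes mult :: "'v \<Rightarrow> 'v \<Rightarrow> 'v"  (infixl \<open>\<odot>\<close> 75)
  assumes mult_commute: "x \<odot> y = y \<odot> x"
    and mult_add_left: "(x + y) \<odot> z = x \<odot> z + y \<odot> z"
    and mult_scale_left: "(t *\<^sub>F x) \<odot> y = t *\<^sub>F (x \<odot> y)"
begin

definition subalgebra :: "'v set \<Rightarrow> bool" where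
  "subalgebra S \<longleftrightarrow> subspace S \<and> (\<forall>x\<in>S. \<forall>y\<in>S. x \<odot> y \<in> S)"

definition ad :: "'v \<Rightarrow> 'v \<Rightarrow> 'v" where
  "ad a x = x \<odot> a"

definition eigenspace :: "'v \<Rightarrow> 'k \<Rightarrow> 'v set" where
  "eigenspace a t = {x. ad a x = t *\<^sub>F x}"

definition poly_op :: "'k poly \<Rightarrow> ('v \<Rightarrow> 'v) \<Rightarrow> 'v \<Rightarrow> 'v" where
  "poly_op p T x = (\<Sum>i\<le>degree p. coeff p i *\<^sub>F (T ^^ i) x)"

text \<open>The algebra may have infinite dimension, so a minimal polynomial need not exist in
  general; hence a predicate.\<close>

definition is_minimal_poly :: "('v \<Rightarrow> 'v) \<Rightarrow> 'k poly \<Rightarrow> bool" where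
  "is_minimal_poly T m \<longleftrightarrow> lead_coeff m = 1 \<and> (\<forall>x. poly_op m T x = 0) \<and>
     (\<forall>q. q \<noteq> 0 \<and> (\<forall>x. poly_op q T x = 0) \<longrightarrow> degree m \<le> degree q)"

text \<open>In the fusion rules, \<open>A + B\<close> is the sum of subspaces.\<close>

definition jordan_axis :: "'k \<Rightarrow> 'v \<Rightarrow> bool" where
  "jordan_axis \<eta> a \<longleftrightarrow>
     a \<odot> a = a \<and>
     (\<exists>m. is_minimal_poly (ad a) m \<and> m dvd [:-1, 1:] * [:0, 1:] * [:-\<eta>, 1:]) \<and>
     (\<forall>x\<in>eigenspace a 1. \<forall>y\<in>eigenspace a 1. x \<odot> y \<in> eigenspace a 1) \<and>
     (\<forall>x\<in>eigenspace a 0. \<forall>y\<in>eigenspace a 0. x \<odot> y \<in> eigenspace a 0) \<and>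
     (\<forall>x\<in>eigenspace a 1. \<forall>y\<in>eigenspace a 0. x \<odot> y = 0) \<and>
     (\<forall>x\<in>eigenspace a 0 + eigenspace a 1. \<forall>y\<in>eigenspace a \<eta>. x \<odot> y \<in> eigenspace a \<eta>) \<and>
     (\<forall>x\<in>eigenspace a \<eta>. \<forall>y\<in>eigenspace a \<eta>. x \<odot> y \<in> eigenspace a 0 + eigenspace a 1)"

definition primitive :: "'v \<Rightarrow> bool" where
  "primitive a \<longleftrightarrow> eigenspace a 1 = span {a} \<and> dim (eigenspace a 1) = 1"

text \<open>The component of \<open>y\<close> in the 1-eigenspace of \<open>a\<close>, along the sum of the other two
  eigenspaces. It is meaningful if \<open>a\<close> is an axis and \<open>\<eta> \<noteq> 0, 1\<close>; \<open>\<phi>\<close> needs moreover that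
  \<open>a\<close> is primitive.\<close>

definition proj_axis :: "'k \<Rightarrow> 'v \<Rightarrow> 'v \<Rightarrow> 'v" where
  "proj_axis \<eta> a y =
     (THE p. p \<in> eigenspace a 1 \<and> y - p \<in> eigenspace a 0 + eigenspace a \<eta>)"

definition \<phi> :: "'k \<Rightarrow> 'v \<Rightarrow> 'v \<Rightarrow> 'k" where
  "\<phi> \<eta> a y = (THE t. proj_axis \<eta> a y = t *\<^sub>F a)"

end

locale axial_algebra_jordan_type = comm_nonassoc_algebra scale mult
  for scale :: "'k::field \<Rightarrow> 'v::ab_group_add \<Rightarrow> 'v"  (infixr \<open>*\<^sub>F\<close> 76)
    and mult :: "'v \<Rightarrow> 'v \<Rightarrow> 'v"  (infixl \<open>\<odot>\<close> 75) +
  fixes \<eta> :: 'k and X :: "'v set"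
  assumes eta_neq_0: "\<eta> \<noteq> 0" and eta_neq_1: "\<eta> \<noteq> 1"
    and generated: "subalgebra hull X = UNIV"
    and axes: "\<And>a. a \<in> X \<Longrightarrow> jordan_axis \<eta> a"

end

(*
  Fix a primitive axis a, write f for phi_a and P x = ax - f(x) a; P x is eta times the
  eta-component of x. The fusion rules give three identities for the single axis a, valid for all
  x and y: a(ax) = eta ax + (1 - eta) f(x) a; the multiplicativity of the Miyamoto involution
  x |-> x - (2/eta) P x; and a(x(ay)) = (ax)(ay) + eta (a(xy) - y(ax)). The second one computes
  (ax)(ay), the third one then a(x(ay)).

  Solved for y(ax), the formula for a(x(ay)) expresses c(ab) by b(ac) and multiples of a. So these
  identities, used for the three axes in turn, compute all products of the nine monomials; hence
  their span is a subalgebra.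

  For eta = 1/2, computing (ab)^2 through a and through b shows phi_a(b) = phi_b(a). Applied to a
  and the image of b under the Miyamoto involution of c, this gives phi_a(bc) = phi_b(ac), so that
  the four scalars alpha, beta, gamma, psi determine the whole table.
*)

theory Submission
  imports Defs
begin

context comm_nonassoc_algebra
begin

section \<open>Bilinearity of the product and separation by linear functionals\<close>

lemma mult_scale_right: "x \<odot> (t *\<^sub>F y) = t *\<^sub>F (x \<odot> y)"
  using mult_scale_left mult_commute by metis

lemma mult_add_right: "x \<odot> (y + z) = x \<odot> y + x \<odot> z"
  using mult_add_left mult_commute by metis

lemma mult_zero_left: "0 \<odot> y = 0"
  using mult_scale_left[of 0 0 y] by simp

lemma mult_zero_right: "x \<odot> 0 = 0"
  using mult_zero_left mult_commute by metis

lemma mult_minus_left: "(- x) \<odot> y = - (x \<odot> y)"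
  using mult_scale_left[of "-1" x y] by simp

lemma mult_minus_right: "x \<odot> (- y) = - (x \<odot> y)"
  using mult_minus_left mult_commute by metis

lemma mult_diff_left: "(x - y) \<odot> z = x \<odot> z - y \<odot> z"
  using mult_add_left[of x "- y" z] by (simp add: mult_minus_left)

lemma mult_diff_right: "x \<odot> (y - z) = x \<odot> y - x \<odot> z"
  using mult_diff_left mult_commute by metis

lemmas bilinear = mult_add_left mult_add_right mult_diff_left mult_diff_right
  mult_scale_left mult_scale_right mult_zero_left mult_zero_right mult_minus_left mult_minus_right

text \<open>Linear functionals separate points, which turns an identity between linear combinations
  into an identity of scalars.\<close>

lemma eq_by_functionals:
  assumes "\<And>F :: 'v \<Rightarrow> 'k. \<lbrakk>\<And>x y. F (x + y) = F x + F y; \<And>t x. F (t *\<^sub>F x) = t * F x;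
    \<And>x y. F (x - y) = F x - F y; \<And>x. F (- x) = - F x; F 0 = 0\<rbrakk> \<Longrightarrow> F u = F v"
  shows "u = v"
proof (rule ccontr)
  assume "u \<noteq> v"
  then have "independent {u - v}"
    by simp
  interpret K: vector_space "(*) :: 'k \<Rightarrow> 'k \<Rightarrow> 'k"
    by unfold_locales (simp_all add: algebra_simps)
  interpret P: vector_space_pair scale "(*) :: 'k \<Rightarrow> 'k \<Rightarrow> 'k"
    by unfold_locales
  obtain F where F: "Vector_Spaces.linear scale (*) F" "F (u - v) = (1 :: 'k)"
    using P.linear_independent_extend[OF \<open>independent {u - v}\<close>, of "\<lambda>_. 1"] by auto
  interpret F: Vector_Spaces.linear scale "(*)" F by (fact F(1))
  have "F u = F v"
    by (rule assms) (simp_all add: F.add F.scale F.diff F.neg F.zero)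
  then show False
    using F(2) by (simp add: F.diff)
qed

subsection \<open>The eigenspace decomposition\<close>

text \<open>Coefficients above the degree vanish. A common bound lets polynomials of different
  degrees be added termwise.\<close>

lemma poly_op_eq:
  assumes "degree p \<le> n"
  shows "poly_op p T x = (\<Sum>i\<le>n. coeff p i *\<^sub>F (T ^^ i) x)"
  unfolding poly_op_def using assms
  by (intro sum.mono_neutral_left) (auto simp: coeff_eq_0)

lemma poly_op_add: "poly_op (p + q) T x = poly_op p T x + poly_op q T x"
proof -
  let ?n = "max (degree p) (degree q)"
  have "degree (p + q) \<le> ?n"
    by (simp add: degree_add_le_max)
  then show ?thesis
    using poly_op_eq[of p ?n] poly_op_eq[of q ?n] poly_op_eq[of "p + q" ?n]
    by (simp add: scale_left_distrib sum.distrib)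
qed

lemma poly_op_smult: "poly_op (smult t p) T x = t *\<^sub>F poly_op p T x"
  using poly_op_eq[of "smult t p" "degree p"]
  by (simp add: poly_op_def scale_sum_right)

lemma poly_op_pCons: "poly_op (pCons t p) T x = t *\<^sub>F x + poly_op p T (T x)"
proof -
  have "poly_op (pCons t p) T x = (\<Sum>i\<le>Suc (degree p). coeff (pCons t p) i *\<^sub>F (T ^^ i) x)"
    by (rule poly_op_eq) (simp add: degree_pCons_le)
  then show ?thesis
    by (simp only: sum.atMost_Suc_shift) (simp add: poly_op_def funpow_swap1)
qed

lemma poly_op_0: "poly_op 0 T x = 0"
  by (simp add: poly_op_def)

text \<open>The annihilating polynomials form an ideal. The induction is over all \<open>x\<close>
  because \<open>poly_op_pCons\<close> moves one application of \<open>T\<close> onto the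
  argument.\<close>

lemma poly_op_mult_eq_0:
  assumes "\<And>x. poly_op m T x = 0"
  shows "poly_op (q * m) T x = 0"
proof (induction q arbitrary: x)
  case 0
  then show ?case by (simp add: poly_op_0)
next
  case (pCons t q)
  then show ?case
    by (simp add: poly_op_add poly_op_smult poly_op_pCons assms)
qed

text \<open>The cubic is a multiple of the minimal polynomial, so it annihilates
  \<open>ad a\<close>; it expands to \<open>t^3 - (1 + \<eta>) * t^2 + \<eta> * t\<close>.\<close>

lemma jordan_axis_ad_cubic:
  assumes "jordan_axis \<eta> a"
  shows "a \<odot> (a \<odot> (a \<odot> x)) = (1 + \<eta>) *\<^sub>F (a \<odot> (a \<odot> x)) - \<eta> *\<^sub>F (a \<odot> x)"
proof -
  obtain m where "is_minimal_poly (ad a) m" and dvd: "m dvd [:-1, 1:] * [:0, 1:] * [:-\<eta>, 1:]"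
    using assms by (auto simp: jordan_axis_def)
  then have "\<And>x. poly_op m (ad a) x = 0"
    by (simp add: is_minimal_poly_def)
  moreover obtain q where "[:-1, 1:] * [:0, 1:] * [:-\<eta>, 1:] = q * m"
    using dvd by (metis dvdE mult.commute)
  ultimately have "poly_op ([:-1, 1:] * [:0, 1:] * [:-\<eta>, 1:]) (ad a) x = 0"
    by (simp add: poly_op_mult_eq_0)
  then have "a \<odot> (a \<odot> (a \<odot> x)) - (1 + \<eta>) *\<^sub>F (a \<odot> (a \<odot> x)) + \<eta> *\<^sub>F (a \<odot> x) = 0"
    by (simp add: poly_op_pCons poly_op_0 ad_def mult_commute scale_left_distrib
        scale_left_diff_distrib algebra_simps)
  then show ?thesis
    by (simp add: algebra_simps)
qed

lemma eigenspace_iff: "x \<in> eigenspace a t \<longleftrightarrow> a \<odot> x = t *\<^sub>F x"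
  by (simp add: eigenspace_def ad_def mult_commute)

text \<open>Existence and uniqueness of the component in the 1-eigenspace resolve the two definite
  descriptions on which \<open>\<phi>\<close> is built.\<close>

lemma primitive_axis_decomposition:
  assumes "\<eta> \<noteq> 0" "\<eta> \<noteq> 1" "jordan_axis \<eta> a" "primitive a"
  shows "\<exists>x0 x\<eta>. x = \<phi> \<eta> a x *\<^sub>F a + x0 + x\<eta> \<and> x0 \<in> eigenspace a 0 \<and> x\<eta> \<in> eigenspace a \<eta>"
    and "a \<noteq> 0"
proof -
  have e: "\<eta> - 1 \<noteq> 0" using assms(2) by simp
  have E1: "eigenspace a 1 = span {a}"
    using assms(4) by (simp add: primitive_def)
  show a0: "a \<noteq> 0"
  proof
    assume "a = 0"
    then have "dim (eigenspace a 1) = 0"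
      unfolding E1 using dim_span_eq_card_independent[OF independent_empty]
      by (simp only: span_insert_0 card.empty)
    with assms(4) show False by (simp add: primitive_def)
  qed
  \<comment> \<open>Lagrange interpolation at the eigenvalues: with \<open>T = ad a\<close>, the
    projector \<open>T (T - \<eta>) / (1 - \<eta>)\<close> gives \<open>p\<close> and
    \<open>T (T - 1) / (\<eta> (\<eta> - 1))\<close> gives \<open>w\<close>; the rest
    \<open>v\<close> lies in the kernel.\<close>
  define p where "p = (1 / (1 - \<eta>)) *\<^sub>F (a \<odot> (a \<odot> x) - \<eta> *\<^sub>F (a \<odot> x))"
  define w where "w = (1 / (\<eta> * (\<eta> - 1))) *\<^sub>F (a \<odot> (a \<odot> x) - a \<odot> x)"
  define v where "v = x - p - w"
  note cubic = jordan_axis_ad_cubic[OF assms(3), of x]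
  have p: "p \<in> eigenspace a 1"
    unfolding eigenspace_iff p_def bilinear cubic
    by (rule eq_by_functionals) (simp (no_asm_simp) add: algebra_simps)
  have w: "w \<in> eigenspace a \<eta>"
    unfolding eigenspace_iff w_def bilinear cubic
    by (rule eq_by_functionals) (simp (no_asm_simp) add: algebra_simps)
  have v: "v \<in> eigenspace a 0"
    unfolding eigenspace_iff v_def w_def p_def bilinear cubic
    by (rule eq_by_functionals) (use assms(1,2) e in \<open>simp add: divide_simps; simp add: algebra_simps\<close>)
  \<comment> \<open>The formula defining \<open>p\<close> returns the 1-component of any admissible
    splitting of \<open>x\<close>.\<close>
  have uniq: "p' = p" if p': "p' \<in> eigenspace a 1" and diff: "x - p' \<in> eigenspace a 0 + eigenspace a \<eta>" for p'
  proof -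
    obtain u0 u where "x - p' = u0 + u" "u0 \<in> eigenspace a 0" "u \<in> eigenspace a \<eta>"
      using diff by (rule set_plus_elim)
    with p' have u: "x - p' = u0 + u" "a \<odot> u0 = 0" "a \<odot> u = \<eta> *\<^sub>F u" "a \<odot> p' = p'"
      by (simp_all add: eigenspace_iff)
    have x: "x = p' + (u0 + u)" using u(1) by (simp add: algebra_simps)
    show ?thesis
      unfolding p_def x bilinear u(2-)
      by (rule eq_by_functionals) (use assms(1,2) e in \<open>simp add: divide_simps; simp add: algebra_simps\<close>)
  qed
  have mem: "x - p \<in> eigenspace a 0 + eigenspace a \<eta>"
    using set_plus_intro[OF v w] by (simp add: v_def)
  have proj: "proj_axis \<eta> a x = p"
    unfolding proj_axis_def by (rule the_equality) (use p mem uniq in blast)+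
  obtain t where t: "p = t *\<^sub>F a"
    using p unfolding E1 span_singleton by blast
  have "\<phi> \<eta> a x = t"
    unfolding \<phi>_def proj t by (rule the_equality) (simp_all add: a0)
  then have "x = \<phi> \<eta> a x *\<^sub>F a + v + w"
    by (simp add: v_def t)
  then show "\<exists>x0 x\<eta>. x = \<phi> \<eta> a x *\<^sub>F a + x0 + x\<eta> \<and> x0 \<in> eigenspace a 0 \<and> x\<eta> \<in> eigenspace a \<eta>"
    using v w by blast
qed

section \<open>Identities for a single primitive axis\<close>

text \<open>This is \<open>\<eta>\<close> times the component of \<open>x\<close> in the \<open>\<eta>\<close>-eigenspace, if \<open>f\<close> is \<open>\<phi> \<eta> a\<close>.\<close>

definition eta_part :: "('v \<Rightarrow> 'k) \<Rightarrow> 'v \<Rightarrow> 'v \<Rightarrow> 'v" where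
  "eta_part f a x = a \<odot> x - f x *\<^sub>F a"

text \<open>All that is used about a primitive axis. The condition on \<open>eta_part\<close> says that the Miyamoto
  involution is multiplicative; the last one is the Seress lemma, \<open>a \<odot> (x \<odot> z) = (a \<odot> x) \<odot> z\<close> for
  \<open>z\<close> in the sum of the \<open>0\<close>- and the \<open>1\<close>-eigenspace, applied to \<open>z = \<eta> *\<^sub>F y - eta_part f a y\<close>.
  Unlike the fusion rules, these identities are visibly preserved by automorphisms.\<close>

definition axis_form :: "'k \<Rightarrow> 'v \<Rightarrow> ('v \<Rightarrow> 'k) \<Rightarrow> bool" where
  "axis_form \<eta> a f \<longleftrightarrow> a \<noteq> 0 \<and> a \<odot> a = a \<and>
     (\<forall>x. a \<odot> (a \<odot> x) = \<eta> *\<^sub>F (a \<odot> x) + ((1 - \<eta>) * f x) *\<^sub>F a) \<and>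
     (\<forall>x y. \<eta> *\<^sub>F eta_part f a (x \<odot> y) =
        \<eta> *\<^sub>F (x \<odot> eta_part f a y + y \<odot> eta_part f a x) - 2 *\<^sub>F (eta_part f a x \<odot> eta_part f a y)) \<and>
     (\<forall>x y. a \<odot> (x \<odot> (a \<odot> y)) = (a \<odot> x) \<odot> (a \<odot> y) + \<eta> *\<^sub>F (a \<odot> (x \<odot> y) - y \<odot> (a \<odot> x)))"

text \<open>The fusion rules locate the products of the components of \<open>x\<close> and
  \<open>y\<close>; after expansion along these components each identity is a comparison of
  coefficients.\<close>

lemma axis_form_\<phi>:
  assumes "\<eta> \<noteq> 0" "\<eta> \<noteq> 1" "jordan_axis \<eta> a" "primitive a"
  shows "axis_form \<eta> a (\<phi> \<eta> a)"
proof -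
  let ?f = "\<phi> \<eta> a"
  note [simp] = assms(1)
  have e: "1 - \<eta> \<noteq> 0" using assms(2) by simp
  have a0: "a \<noteq> 0" and dec: "\<And>x. \<exists>x0 xe. x = ?f x *\<^sub>F a + x0 + xe \<and> a \<odot> x0 = 0 \<and> a \<odot> xe = \<eta> *\<^sub>F xe"
    using primitive_axis_decomposition[OF assms] by (auto simp: eigenspace_iff)
  have aa: "a \<odot> a = a" using assms(3) by (simp add: jordan_axis_def)
  have one: "\<exists>t. x = t *\<^sub>F a" if "a \<odot> x = x" for x
    using assms(4) that by (auto simp: primitive_def eigenspace_iff set_eq_iff span_singleton)
  have fus0: "a \<odot> (x \<odot> y) = 0" if "a \<odot> x = 0" "a \<odot> y = 0" for x y
    using assms(3) that by (simp add: jordan_axis_def eigenspace_iff)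
  have zero_mem: "0 \<in> eigenspace a t" for t
    by (simp add: eigenspace_iff bilinear)
  have fus0e: "a \<odot> (x \<odot> y) = \<eta> *\<^sub>F (x \<odot> y)" if "a \<odot> x = 0" "a \<odot> y = \<eta> *\<^sub>F y" for x y
  proof -
    have "x \<in> eigenspace a 0 + eigenspace a 1"
      using that(1) zero_mem[of 1] set_plus_intro[of x "eigenspace a 0" 0 "eigenspace a 1"]
      by (simp add: eigenspace_iff)
    moreover have "y \<in> eigenspace a \<eta>" using that(2) by (simp add: eigenspace_iff)
    ultimately have "x \<odot> y \<in> eigenspace a \<eta>"
      using assms(3) unfolding jordan_axis_def by blast
    then show ?thesis by (simp add: eigenspace_iff)
  qed
  have fusee: "\<exists>u t. x \<odot> y = u + t *\<^sub>F a \<and> a \<odot> u = 0" if "a \<odot> x = \<eta> *\<^sub>F x" "a \<odot> y = \<eta> *\<^sub>F y" for x y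
  proof -
    have "x \<odot> y \<in> eigenspace a 0 + eigenspace a 1"
      using assms(3) that unfolding jordan_axis_def by (simp add: eigenspace_iff)
    then obtain u v where "x \<odot> y = u + v" "a \<odot> u = 0" "a \<odot> v = v"
      by (auto simp: set_plus_def eigenspace_iff)
    then show ?thesis using one[of v] by blast
  qed
  \<comment> \<open>Applying \<open>T (T - \<eta>)\<close> with \<open>T = ad a\<close> kills
    \<open>x0\<close> and \<open>xe\<close> and leaves \<open>(1 - \<eta>) * t\<close> times
    \<open>a\<close>, which determines \<open>t\<close>.\<close>
  have uniq: "?f x = t" if "x = t *\<^sub>F a + x0 + xe" "a \<odot> x0 = 0" "a \<odot> xe = \<eta> *\<^sub>F xe" for x t x0 xe
  proof -
    obtain y0 ye where y: "x = ?f x *\<^sub>F a + y0 + ye" "a \<odot> y0 = 0" "a \<odot> ye = \<eta> *\<^sub>F ye"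
      using dec by blast
    have 1: "a \<odot> (a \<odot> x) - \<eta> *\<^sub>F (a \<odot> x) = ((1 - \<eta>) * t) *\<^sub>F a"
      unfolding that(1) bilinear that(2-) aa
      by (rule eq_by_functionals) (simp (no_asm_simp) add: algebra_simps)
    have 2: "a \<odot> (a \<odot> x) - \<eta> *\<^sub>F (a \<odot> x) = ((1 - \<eta>) * ?f x) *\<^sub>F a"
      by (subst (1 2) y(1), unfold bilinear y(2-) aa)
        (rule eq_by_functionals, simp (no_asm_simp) add: algebra_simps)
    from 1 2 show ?thesis using a0 e by simp
  qed
  have square: "a \<odot> (a \<odot> x) = \<eta> *\<^sub>F (a \<odot> x) + ((1 - \<eta>) * ?f x) *\<^sub>F a" for x
  proof -
    obtain y0 ye where y: "x = ?f x *\<^sub>F a + y0 + ye" "a \<odot> y0 = 0" "a \<odot> ye = \<eta> *\<^sub>F ye"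
      using dec by blast
    show ?thesis
      by (subst (1 2) y(1), unfold bilinear y(2-) aa)
        (rule eq_by_functionals, simp (no_asm_simp) add: algebra_simps)
  qed
  have main: "\<eta> *\<^sub>F eta_part ?f a (x \<odot> y) =
        \<eta> *\<^sub>F (x \<odot> eta_part ?f a y + y \<odot> eta_part ?f a x) - 2 *\<^sub>F (eta_part ?f a x \<odot> eta_part ?f a y)
     \<and> a \<odot> (x \<odot> (a \<odot> y)) = (a \<odot> x) \<odot> (a \<odot> y) + \<eta> *\<^sub>F (a \<odot> (x \<odot> y) - y \<odot> (a \<odot> x))" for x y
  proof -
    obtain x0 xe where x: "x = ?f x *\<^sub>F a + x0 + xe" "a \<odot> x0 = 0" "a \<odot> xe = \<eta> *\<^sub>F xe"
      using dec by blast
    obtain y0 ye where y: "y = ?f y *\<^sub>F a + y0 + ye" "a \<odot> y0 = 0" "a \<odot> ye = \<eta> *\<^sub>F ye"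
      using dec by blast
    \<comment> \<open>The coefficients get names free of \<open>x\<close> and \<open>y\<close>:
      unfolding an equation for \<open>x\<close> with \<open>?f x\<close> on its right side would
      loop.\<close>
    obtain r s where r: "x = r *\<^sub>F a + x0 + xe" "r = ?f x" and s: "y = s *\<^sub>F a + y0 + ye" "s = ?f y"
      using x y by blast
    obtain u t where u: "xe \<odot> ye = u + t *\<^sub>F a" "a \<odot> u = 0"
      using fusee x(3) y(3) by blast
    note E = x(2,3) y(2,3) fus0[OF x(2) y(2)] fus0e[OF x(2) y(3)] fus0e[OF y(2) x(3)] u(2) aa
    have px: "eta_part ?f a x = \<eta> *\<^sub>F xe"
      unfolding eta_part_def r(2)[symmetric] unfolding r(1) bilinear E by simp
    have py: "eta_part ?f a y = \<eta> *\<^sub>F ye"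
      unfolding eta_part_def s(2)[symmetric] unfolding s(1) bilinear E by simp
    have comm: "x0 \<odot> a = 0" "xe \<odot> a = \<eta> *\<^sub>F xe" "y0 \<odot> a = 0" "ye \<odot> a = \<eta> *\<^sub>F ye"
      "xe \<odot> y0 = y0 \<odot> xe" "ye \<odot> x0 = x0 \<odot> ye" "y0 \<odot> x0 = x0 \<odot> y0" "ye \<odot> xe = u + t *\<^sub>F a"
      using E u mult_commute by metis+
    \<comment> \<open>Grouped by the eigenvalues 1, 0 and \<eta>, so that \<open>uniq\<close> reads
      off the value of the form.\<close>
    have xy: "x \<odot> y = (r * s + t) *\<^sub>F a + (x0 \<odot> y0 + u) + (x0 \<odot> ye + y0 \<odot> xe + (r * \<eta>) *\<^sub>F ye + (s * \<eta>) *\<^sub>F xe)"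
      unfolding r(1) s(1) bilinear E comm u(1)
      by (rule eq_by_functionals) (simp (no_asm_simp) add: algebra_simps)
    have pxy: "eta_part ?f a (x \<odot> y) = \<eta> *\<^sub>F (x0 \<odot> ye + y0 \<odot> xe + (r * \<eta>) *\<^sub>F ye + (s * \<eta>) *\<^sub>F xe)"
    proof -
      have fxy: "?f (x \<odot> y) = r * s + t"
        by (rule uniq[OF xy]; unfold bilinear E; rule eq_by_functionals; simp (no_asm_simp) add: algebra_simps)
      show ?thesis
        unfolding eta_part_def fxy unfolding xy bilinear E
        by (intro eq_by_functionals) (simp (no_asm_simp) add: algebra_simps)
    qed
    have "\<eta> *\<^sub>F eta_part ?f a (x \<odot> y) =
        \<eta> *\<^sub>F (x \<odot> eta_part ?f a y + y \<odot> eta_part ?f a x) - 2 *\<^sub>F (eta_part ?f a x \<odot> eta_part ?f a y)"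
      unfolding px py pxy unfolding r(1) s(1) bilinear E comm u(1)
      by (rule eq_by_functionals) (simp (no_asm_simp) add: algebra_simps)
    moreover have "a \<odot> (x \<odot> (a \<odot> y)) = (a \<odot> x) \<odot> (a \<odot> y) + \<eta> *\<^sub>F (a \<odot> (x \<odot> y) - y \<odot> (a \<odot> x))"
      unfolding r(1) s(1) bilinear E comm u(1)
      by (rule eq_by_functionals) (simp (no_asm_simp) add: algebra_simps)
    ultimately show ?thesis by blast
  qed
  show ?thesis
    unfolding axis_form_def
    by (intro conjI allI a0 aa square main[THEN conjunct1] main[THEN conjunct2])
qed

lemma axis_formD:
  assumes "axis_form \<eta> a f"
  shows "a \<noteq> 0" "a \<odot> a = a" "a \<odot> (a \<odot> x) = \<eta> *\<^sub>F (a \<odot> x) + ((1 - \<eta>) * f x) *\<^sub>F a"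
    "\<eta> *\<^sub>F eta_part f a (x \<odot> y) =
        \<eta> *\<^sub>F (x \<odot> eta_part f a y + y \<odot> eta_part f a x) - 2 *\<^sub>F (eta_part f a x \<odot> eta_part f a y)"
    "a \<odot> (x \<odot> (a \<odot> y)) = (a \<odot> x) \<odot> (a \<odot> y) + \<eta> *\<^sub>F (a \<odot> (x \<odot> y) - y \<odot> (a \<odot> x))"
  using assms by (simp_all add: axis_form_def)

text \<open>Neither \<open>a\<close> nor \<open>1 - \<eta>\<close> vanishes, so the identity for
  \<open>a \<odot> (a \<odot> x)\<close> determines \<open>f x\<close>. Linearity of
  \<open>f\<close>, which is not part of \<open>axis_form\<close>, is derived in this way.\<close>

lemma axis_form_eqI:
  assumes "axis_form \<eta> a f" "\<eta> \<noteq> 1" "a \<odot> (a \<odot> x) = \<eta> *\<^sub>F (a \<odot> x) + ((1 - \<eta>) * t) *\<^sub>F a"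
  shows "f x = t"
proof -
  have "((1 - \<eta>) * f x) *\<^sub>F a = ((1 - \<eta>) * t) *\<^sub>F a"
    using axis_formD(3)[OF assms(1), of x] assms(3) by (metis add_left_imp_eq)
  then have "(1 - \<eta>) * f x = (1 - \<eta>) * t"
    using axis_formD(1)[OF assms(1)] by (rule scale_right_imp_eq[rotated])
  then show ?thesis using assms(2) by simp
qed

lemma axis_form_linear:
  assumes "axis_form \<eta> a f" "\<eta> \<noteq> 1"
  shows "f (x + y) = f x + f y" "f (t *\<^sub>F x) = t * f x" "f (x - y) = f x - f y" "f a = 1"
    "f (a \<odot> x) = f x"
proof -
  note D = axis_formD[OF assms(1)]
  show "f (x + y) = f x + f y"
    by (rule axis_form_eqI[OF assms]) (simp add: bilinear D(3) algebra_simps)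
  show "f (t *\<^sub>F x) = t * f x"
    by (rule axis_form_eqI[OF assms]) (simp add: bilinear D(3) algebra_simps)
  show "f (x - y) = f x - f y"
    by (rule axis_form_eqI[OF assms]) (simp add: bilinear D(3) algebra_simps)
  show "f a = 1"
    by (rule axis_form_eqI[OF assms]) (simp add: D(2) algebra_simps)
  show "f (a \<odot> x) = f x"
    by (rule axis_form_eqI[OF assms], subst D(3)) (simp add: bilinear D(2))
qed

text \<open>Once \<open>eta_part\<close> is expanded, the Miyamoto condition is a linear equation
  for this product with leading coefficient 2.\<close>

lemma axis_form_mult_mult:
  assumes "axis_form \<eta> a f" "\<eta> \<noteq> 0" and two: "(2 :: 'k) \<noteq> 0"
  shows "(a \<odot> x) \<odot> (a \<odot> y) =
    (\<eta> / 2) *\<^sub>F (f (x \<odot> y) *\<^sub>F a + x \<odot> (a \<odot> y) + y \<odot> (a \<odot> x) - a \<odot> (x \<odot> y)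
      + f y *\<^sub>F (a \<odot> x) + f x *\<^sub>F (a \<odot> y)) + ((1 - 2 * \<eta>) * f x * f y) *\<^sub>F a"
proof -
  note D = axis_formD[OF assms(1)]
  have comm: "x \<odot> a = a \<odot> x" "y \<odot> a = a \<odot> y" "(a \<odot> x) \<odot> a = a \<odot> (a \<odot> x)"
    by (rule mult_commute)+
  note E = D(4)[of x y, unfolded eta_part_def bilinear D(2) comm D(3)]
  show ?thesis
  proof (rule eq_by_functionals)
    fix F :: "'v \<Rightarrow> 'k"
    assume F: "\<And>x y. F (x + y) = F x + F y" "\<And>t x. F (t *\<^sub>F x) = t * F x"
      "\<And>x y. F (x - y) = F x - F y"
    \<comment> \<open>With \<open>\<eta> = 2 * k\<close> the equation has no denominators, and the
      common factor 2 is cancelled at the end.\<close>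
    define k where "k = \<eta> / 2"
    have k: "\<eta> = 2 * k" using two by (simp add: k_def)
    have "2 * F ((a \<odot> x) \<odot> (a \<odot> y)) = 2 * (k * (f (x \<odot> y) * F a + F (x \<odot> (a \<odot> y))
      + F (y \<odot> (a \<odot> x)) - F (a \<odot> (x \<odot> y)) + f y * F (a \<odot> x) + f x * F (a \<odot> y))
      + (1 - 2 * \<eta>) * f x * f y * F a)"
      using arg_cong[OF E, of F] unfolding F k by (simp add: algebra_simps)
    then show "F ((a \<odot> x) \<odot> (a \<odot> y)) = F ((\<eta> / 2) *\<^sub>F (f (x \<odot> y) *\<^sub>F a + x \<odot> (a \<odot> y) + y \<odot> (a \<odot> x) - a \<odot> (x \<odot> y)
      + f y *\<^sub>F (a \<odot> x) + f x *\<^sub>F (a \<odot> y)) + ((1 - 2 * \<eta>) * f x * f y) *\<^sub>F a)"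
      unfolding F k_def[symmetric] using two by (simp only: mult_cancel_left simp_thms)
  qed
qed

text \<open>Applying \<open>f\<close> to the Seress identity for \<open>(x, y)\<close> and for
  \<open>(y, x)\<close> gives two equations whose difference is
  \<open>(1 - \<eta>) * (u - v) = 0\<close>. With \<open>u = v\<close>, the terms
  \<open>\<eta> * u\<close> cancel against those from the product formula.\<close>

lemma axis_form_mult_nested:
  assumes "axis_form \<eta> a f" "\<eta> \<noteq> 0" "\<eta> \<noteq> 1" "(2 :: 'k) \<noteq> 0"
  shows "f (x \<odot> (a \<odot> y)) = \<eta> * f (x \<odot> y) + (1 - \<eta>) * f x * f y"
proof -
  note D = axis_formD[OF assms(1)]
  note L = axis_form_linear[OF assms(1,3)]
  note M = axis_form_mult_mult[OF assms(1,2,4)]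
  define u v where "u = f (x \<odot> (a \<odot> y))" and "v = f (y \<odot> (a \<odot> x))"
  have 1: "f ((a \<odot> x) \<odot> (a \<odot> y)) = (\<eta> / 2) * (u + v + 2 * f x * f y) + (1 - 2 * \<eta>) * f x * f y"
    unfolding M L u_def v_def by (simp add: algebra_simps)
  have 2: "u = f ((a \<odot> x) \<odot> (a \<odot> y)) + \<eta> * (f (x \<odot> y) - v)"
    using arg_cong[OF D(5)[of x y], of f] unfolding L u_def v_def .
  have 3: "v = f ((a \<odot> x) \<odot> (a \<odot> y)) + \<eta> * (f (x \<odot> y) - u)"
    using arg_cong[OF D(5)[of y x], of f]
    unfolding L u_def v_def mult_commute[of y x] mult_commute[of "a \<odot> y" "a \<odot> x"] .
  define p where "p = f ((a \<odot> x) \<odot> (a \<odot> y))"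
  define w where "w = f (x \<odot> y)"
  note 1 = 1[folded p_def] and 2 = 2[folded p_def w_def] and 3 = 3[folded p_def w_def]
  have "u - v = (p + \<eta> * (w - v)) - (p + \<eta> * (w - u))"
    by (simp only: 2[symmetric] 3[symmetric])
  also have "\<dots> = \<eta> * (u - v)"
    by (simp add: algebra_simps)
  finally have "(1 - \<eta>) * (u - v) = 0"
    unfolding left_diff_distrib[of 1] by (simp only: mult_1 diff_self)
  then have uv: "v = u" using assms(3) by simp
  have "(\<eta> / 2) * (u + v + 2 * f x * f y) = (\<eta> / 2) * (2 * (u + f x * f y))"
    unfolding uv by (simp add: algebra_simps)
  then have p: "p = \<eta> * (u + f x * f y) + (1 - 2 * \<eta>) * f x * f y"
    unfolding 1 using assms(4) by simp
  have "u = p + \<eta> * (w - u)"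
    using 2 uv by simp
  also have "\<dots> = \<eta> * w + (1 - \<eta>) * f x * f y"
    unfolding p by (simp add: algebra_simps)
  finally show ?thesis by (simp only: u_def w_def)
qed

section \<open>The Miyamoto involution and the transport of axes along it\<close>

definition miyamoto :: "'k \<Rightarrow> ('v \<Rightarrow> 'k) \<Rightarrow> 'v \<Rightarrow> 'v \<Rightarrow> 'v" where
  "miyamoto \<eta> f a x = x - (2 / \<eta>) *\<^sub>F eta_part f a x"

text \<open>For a primitive axis with \<open>f = \<phi> \<eta> a\<close>, this map negates the
  \<eta>-component and fixes the others. Multiplicativity is the \<open>eta_part\<close> condition
  divided by \<eta>; the map is an involution because \<open>eta_part\<close>, applied twice, is
  \<eta> times itself.\<close>

lemma miyamoto_automorphism:
  assumes "axis_form \<eta> a f" "\<eta> \<noteq> 0" "\<eta> \<noteq> 1"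
  shows "miyamoto \<eta> f a (x + y) = miyamoto \<eta> f a x + miyamoto \<eta> f a y"
    and "miyamoto \<eta> f a (t *\<^sub>F x) = t *\<^sub>F miyamoto \<eta> f a x"
    and "miyamoto \<eta> f a (x \<odot> y) = miyamoto \<eta> f a x \<odot> miyamoto \<eta> f a y"
    and "miyamoto \<eta> f a (miyamoto \<eta> f a x) = x"
proof -
  note D = axis_formD[OF assms(1)]
  note L = axis_form_linear[OF assms(1,3)]
  show "miyamoto \<eta> f a (x + y) = miyamoto \<eta> f a x + miyamoto \<eta> f a y"
    unfolding miyamoto_def eta_part_def bilinear L
    by (rule eq_by_functionals) (simp (no_asm_simp) add: algebra_simps)
  show "miyamoto \<eta> f a (t *\<^sub>F x) = t *\<^sub>F miyamoto \<eta> f a x"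
    unfolding miyamoto_def eta_part_def bilinear L
    by (rule eq_by_functionals) (simp (no_asm_simp) add: algebra_simps)
  show "miyamoto \<eta> f a (miyamoto \<eta> f a x) = x"
    unfolding miyamoto_def eta_part_def bilinear L D(2,3)
    by (rule eq_by_functionals) (use assms(2) in \<open>simp (no_asm_simp) add: field_simps\<close>)
  have "eta_part f a (x \<odot> y) = x \<odot> eta_part f a y + y \<odot> eta_part f a x - (2 / \<eta>) *\<^sub>F (eta_part f a x \<odot> eta_part f a y)"
    using arg_cong[OF D(4)[of x y], of "\<lambda>v. (1 / \<eta>) *\<^sub>F v"] assms(2)
    by (simp add: scale_right_diff_distrib)
  then show "miyamoto \<eta> f a (x \<odot> y) = miyamoto \<eta> f a x \<odot> miyamoto \<eta> f a y"
    unfolding miyamoto_def bilinear mult_commute[of "eta_part f a x" y]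
    by (intro eq_by_functionals) (simp (no_asm_simp) add: algebra_simps)
qed

text \<open>Each identity for \<open>b\<close> is taken at \<open>T x\<close> and \<open>T y\<close>
  and mapped back by \<open>T\<close>, which is its own inverse.\<close>

lemma axis_form_transport:
  assumes ax: "axis_form \<eta> b g"
    and T: "\<And>x y. T (x + y) = T x + T y" "\<And>t x. T (t *\<^sub>F x) = t *\<^sub>F T x"
      "\<And>x y. T (x \<odot> y) = T x \<odot> T y" "\<And>x. T (T x) = x"
  shows "axis_form \<eta> (T b) (g \<circ> T)"
proof -
  note D = axis_formD[OF ax]
  have T0: "T 0 = 0" using T(2)[of 0 0] by simp
  have Tm: "T (- x) = - T x" for x using T(2)[of "-1" x] by simp
  have Td: "T (x - y) = T x - T y" for x y using T(1)[of x "- y"] by (simp add: Tm)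
  note TT = T(1-3) Td
  have eta: "eta_part (g \<circ> T) (T b) x = T (eta_part g b (T x))" for x
    by (simp add: eta_part_def TT T(4))
  have 1: "T b \<noteq> 0" using D(1) T(4)[of b] T0 by metis
  have 2: "T b \<odot> T b = T b" using TT(3)[of b b] unfolding D(2) by (rule sym)
  have 3: "T b \<odot> (T b \<odot> x) = \<eta> *\<^sub>F (T b \<odot> x) + ((1 - \<eta>) * (g \<circ> T) x) *\<^sub>F T b" for x
    using arg_cong[OF D(3)[of "T x"], of T] by (simp add: TT T(4))
  have 4: "\<eta> *\<^sub>F eta_part (g \<circ> T) (T b) (x \<odot> y) =
     \<eta> *\<^sub>F (x \<odot> eta_part (g \<circ> T) (T b) y + y \<odot> eta_part (g \<circ> T) (T b) x)
     - 2 *\<^sub>F (eta_part (g \<circ> T) (T b) x \<odot> eta_part (g \<circ> T) (T b) y)" for x y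
    using arg_cong[OF D(4)[of "T x" "T y"], of T] unfolding eta by (simp add: TT T(4))
  have 5: "T b \<odot> (x \<odot> (T b \<odot> y)) = (T b \<odot> x) \<odot> (T b \<odot> y) + \<eta> *\<^sub>F (T b \<odot> (x \<odot> y) - y \<odot> (T b \<odot> x))" for x y
    using arg_cong[OF D(5)[of "T x" "T y"], of T] by (simp add: TT T(4))
  show ?thesis unfolding axis_form_def by (intro conjI allI 1 2 3 4 5)
qed

subsection \<open>Symmetry of the form in the case one half\<close>

lemma half_neq_1: "(1/2 :: 'k) \<noteq> 1" if "(2 :: 'k) \<noteq> 0"
  using that by (metis divide_eq_1_iff one_add_one add_cancel_right_right zero_neq_one)

text \<open>As a simplification rule, this shows that the powers of two in the denominators do not
  vanish.\<close>

lemma numeral_Bit0_eq_0: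
  assumes "(2 :: 'k) \<noteq> 0"
  shows "(numeral (num.Bit0 n) :: 'k) = 0 \<longleftrightarrow> (numeral n :: 'k) = 0"
proof -
  have "(numeral (num.Bit0 n) :: 'k) = 2 * numeral n"
    unfolding numeral_Bit0[of n] by (rule mult_2[symmetric])
  then show ?thesis using assms by (simp only: mult_eq_0_iff simp_thms)
qed

lemma half_neq_0: "(1/2 :: 'k) \<noteq> 0" if "(2 :: 'k) \<noteq> 0"
  using that by simp

text \<open>Both axes yield an expression for the square of \<open>a \<odot> b\<close>; their difference is a multiple
  of \<open>a \<odot> b\<close>.\<close>

lemma axis_form_half_sym:
  assumes "(2 :: 'k) \<noteq> 0" and a: "axis_form (1/2) a f" and b: "axis_form (1/2) b g"
  shows "f b = g a"
\<comment> \<open>The comparison of the two squares gives nothing if \<open>a \<odot> b\<close>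
  vanishes, but then both values of the forms are 0.\<close>
proof (cases "a \<odot> b = 0")
  case True
  have "f b = 0"
    by (rule axis_form_eqI[OF a half_neq_1]) (use assms(1) True in \<open>simp_all add: bilinear\<close>)
  moreover have "g a = 0"
    by (rule axis_form_eqI[OF b half_neq_1])
      (use assms(1) True in \<open>simp_all add: bilinear mult_commute[of b a]\<close>)
  ultimately show ?thesis by simp
next
  case False
  note [simp] = assms(1) numeral_Bit0_eq_0[OF assms(1)]
  note A = axis_formD[OF a] and B = axis_formD[OF b]
  have ba: "b \<odot> a = a \<odot> b" by (rule mult_commute)
  have bab: "b \<odot> (a \<odot> b) = (1/2) *\<^sub>F (a \<odot> b) + ((1 - 1/2) * g a) *\<^sub>F b"
    using B(3)[of a] unfolding ba .
  have 1: "(a \<odot> b) \<odot> (a \<odot> b) = (1/4) *\<^sub>F (f b *\<^sub>F a + g a *\<^sub>F b) + (f b / 2) *\<^sub>F (a \<odot> b)"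
    unfolding axis_form_mult_mult[OF a half_neq_0[OF assms(1)] assms(1), of b b] bilinear bab A(3) B(2)
    by (rule eq_by_functionals) (simp (no_asm_simp) add: field_simps)
  have 2: "(a \<odot> b) \<odot> (a \<odot> b) = (1/4) *\<^sub>F (f b *\<^sub>F a + g a *\<^sub>F b) + (g a / 2) *\<^sub>F (a \<odot> b)"
    using axis_form_mult_mult[OF b half_neq_0[OF assms(1)] assms(1), of a a]
    unfolding bilinear ba bab A(2,3)
    by (rule trans) (rule eq_by_functionals, simp (no_asm_simp) add: field_simps)
  have "(f b / 2) *\<^sub>F (a \<odot> b) = (g a / 2) *\<^sub>F (a \<odot> b)"
    using 1 2 by (metis add_left_cancel)
  then show ?thesis using False by simp
qed

text \<open>The previous lemma applied to \<open>a\<close> and the image of \<open>b\<close> under the Miyamoto involution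
  of \<open>c\<close>.\<close>

lemma axis_form_half_sym3:
  assumes two: "(2 :: 'k) \<noteq> 0" and a: "axis_form (1/2) a f" and b: "axis_form (1/2) b g"
    and c: "axis_form (1/2) c h"
  shows "f (b \<odot> c) = g (a \<odot> c)"
proof -
  note n = half_neq_0[OF two] half_neq_1[OF two]
  note [simp] = numeral_Bit0_eq_0[OF two]
  let ?T = "miyamoto (1/2) h c"
  note T = miyamoto_automorphism[OF c n(1,2)]
  have "f (?T b) = g (?T a)"
    using axis_form_half_sym[OF two a axis_form_transport[OF b, of ?T, OF T]] by simp
  moreover have "f (?T b) = f b - 4 * (f (b \<odot> c) - h b * f c)"
    by (simp add: miyamoto_def eta_part_def axis_form_linear[OF a n(2)] mult_commute[of c b])
  moreover have "g (?T a) = g a - 4 * (g (a \<odot> c) - h a * g c)"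
    by (simp add: miyamoto_def eta_part_def axis_form_linear[OF b n(2)] mult_commute[of c a])
  \<comment> \<open>By symmetry for pairs, \<open>h b * f c\<close> and \<open>h a * g c\<close>
    agree and drop out.\<close>
  moreover have "f b = g a" "f c = h a" "g c = h b"
    by (rule axis_form_half_sym[OF two a b] axis_form_half_sym[OF two a c] axis_form_half_sym[OF two b c])+
  ultimately have "4 * f (b \<odot> c) = 4 * g (a \<odot> c)"
    by algebra
  then show ?thesis
    by simp
qed

subsection \<open>The spanning set\<close>

lemma axis_form_mult_span:
  assumes "axis_form \<eta> a f" "\<eta> \<noteq> 0" "(2 :: 'k) \<noteq> 0" "subspace S"
    and "a \<in> S" "a \<odot> x \<in> S" "a \<odot> y \<in> S" "a \<odot> (x \<odot> y) \<in> S" "x \<odot> (a \<odot> y) \<in> S" "y \<odot> (a \<odot> x) \<in> S"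
  shows "(a \<odot> x) \<odot> (a \<odot> y) \<in> S"
  unfolding axis_form_mult_mult[OF assms(1-3)]
  by (intro subspace_add subspace_diff subspace_scale assms)

text \<open>The Seress identity with the product formula inserted. It trades
  \<open>y \<odot> (a \<odot> x)\<close> for \<open>x \<odot> (a \<odot> y)\<close> and multiples of
  \<open>a\<close>, whose mutual products are computable.\<close>

lemma axis_form_swap:
  assumes "axis_form \<eta> a f" "\<eta> \<noteq> 0" "(2 :: 'k) \<noteq> 0"
  shows "y \<odot> (a \<odot> x) = x \<odot> (a \<odot> y) - (2 / \<eta>) *\<^sub>F (a \<odot> (x \<odot> (a \<odot> y))) + a \<odot> (x \<odot> y)
    + (f (x \<odot> y) + 2 * (1 - 2 * \<eta>) / \<eta> * f x * f y) *\<^sub>F a + f y *\<^sub>F (a \<odot> x) + f x *\<^sub>F (a \<odot> y)"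
  unfolding axis_formD(5)[OF assms(1)] axis_form_mult_mult[OF assms]
  by (rule eq_by_functionals) (use assms(2,3) in \<open>simp (no_asm_simp) add: field_simps\<close>)

text \<open>The forms are hidden by existential quantifiers, which makes the notion symmetric: each
  closure property needs a proof for one ordering only.\<close>

definition axis_triple :: "'k \<Rightarrow> 'v \<Rightarrow> 'v \<Rightarrow> 'v \<Rightarrow> bool" where
  "axis_triple \<eta> x y z \<longleftrightarrow> (2 :: 'k) \<noteq> 0 \<and> \<eta> \<noteq> 0 \<and>
     (\<exists>f. axis_form \<eta> x f) \<and> (\<exists>g. axis_form \<eta> y g) \<and> (\<exists>h. axis_form \<eta> z h)"

definition monomials :: "'v \<Rightarrow> 'v \<Rightarrow> 'v \<Rightarrow> 'v set" where
  "monomials x y z = {x, y, z, x \<odot> y, x \<odot> z, y \<odot> z, x \<odot> (y \<odot> z), y \<odot> (x \<odot> z), z \<odot> (x \<odot> y)}"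

abbreviation monomial_span :: "'v \<Rightarrow> 'v \<Rightarrow> 'v \<Rightarrow> 'v set" where
  "monomial_span x y z \<equiv> span (monomials x y z)"

lemma axis_triple_permutations:
  assumes "axis_triple \<eta> x y z"
  shows "axis_triple \<eta> x z y" "axis_triple \<eta> y x z" "axis_triple \<eta> y z x" "axis_triple \<eta> z x y"
    "axis_triple \<eta> z y x"
  using assms by (simp_all add: axis_triple_def)

lemma monomials_permutations:
  "monomials x z y = monomials x y z" "monomials y x z = monomials x y z"
  "monomials y z x = monomials x y z" "monomials z x y = monomials x y z"
  "monomials z y x = monomials x y z"
  unfolding monomials_def mult_commute[of y x] mult_commute[of z x] mult_commute[of z y]
  by (simp_all only: insert_commute)

lemma mult_monomials_span:
  assumes s: "s \<in> monomial_span x y z"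
    and B: "w \<odot> x \<in> span C" "w \<odot> y \<in> span C" "w \<odot> z \<in> span C"
      "w \<odot> (x \<odot> y) \<in> span C" "w \<odot> (x \<odot> z) \<in> span C" "w \<odot> (y \<odot> z) \<in> span C"
      "w \<odot> (x \<odot> (y \<odot> z)) \<in> span C" "w \<odot> (y \<odot> (x \<odot> z)) \<in> span C" "w \<odot> (z \<odot> (x \<odot> y)) \<in> span C"
  shows "w \<odot> s \<in> span C"
  using s
proof (induction rule: span_induct_alt)
  case base
  then show ?case by (simp add: bilinear span_zero)
next
  case (step t b s)
  have "w \<odot> b \<in> span C"
    using step(1) B unfolding monomials_def by blast
  then show ?case
    unfolding bilinear using step(2) by (intro span_add span_scale)
qed

lemma mult_mem_commute: "u \<odot> v \<in> A \<Longrightarrow> v \<odot> u \<in> A"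
  by (simp only: mult_commute[of v u])

lemma monomials_mem:
  "x \<in> monomial_span x y z" "y \<in> monomial_span x y z" "z \<in> monomial_span x y z"
  "x \<odot> y \<in> monomial_span x y z" "x \<odot> z \<in> monomial_span x y z"
  "y \<odot> z \<in> monomial_span x y z" "x \<odot> (y \<odot> z) \<in> monomial_span x y z"
  "y \<odot> (x \<odot> z) \<in> monomial_span x y z" "z \<odot> (x \<odot> y) \<in> monomial_span x y z"
  by (auto intro!: span_base simp: monomials_def)

section \<open>Closure of the monomial span under products\<close>

lemmas span_intros = span_add span_diff span_scale

text \<open>The square identity handles monomials that are multiples of \<open>x\<close>. The Seress
  identity reduces \<open>x \<odot> (y \<odot> (x \<odot> z))\<close> and its mirror image to
  \<open>(x \<odot> y) \<odot> (x \<odot> z)\<close>, which the product formula computes.\<close>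

lemma mult_axis_span:
  assumes T: "axis_triple \<eta> x y z" and s: "s \<in> monomial_span x y z"
  shows "x \<odot> s \<in> monomial_span x y z" (is "_ \<in> ?S")
proof -
  obtain f where f: "axis_form \<eta> x f" and e: "\<eta> \<noteq> 0" "(2 :: 'k) \<noteq> 0"
    using T by (auto simp: axis_triple_def)
  note D = axis_formD[OF f]
  note S = monomials_mem[where x = x and y = y and z = z]
  have zy: "z \<odot> y = y \<odot> z" by (rule mult_commute)
  have "(x \<odot> y) \<odot> (x \<odot> z) \<in> ?S"
    by (rule axis_form_mult_span[OF f e subspace_span]) (simp_all add: S)
  note 1 = this this[THEN mult_mem_commute]
  have 2: "x \<odot> (x \<odot> w) \<in> ?S" if "x \<odot> w \<in> ?S" for w
    unfolding D(3) using that S by (intro span_intros)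
  have 3: "x \<odot> (y \<odot> (x \<odot> z)) \<in> ?S" "x \<odot> (z \<odot> (x \<odot> y)) \<in> ?S"
    unfolding D(5) zy by (intro span_intros S 1)+
  show ?thesis
    using s by (rule mult_monomials_span) (simp_all only: D(2) S 2 3)
qed

context
  fixes \<eta> x y z
  assumes T: "axis_triple \<eta> x y z"
begin

lemma axes_closed:
  assumes "s \<in> monomial_span x y z"
  shows "x \<odot> s \<in> monomial_span x y z" "y \<odot> s \<in> monomial_span x y z" "z \<odot> s \<in> monomial_span x y z"
  using assms mult_axis_span[OF T] mult_axis_span[OF axis_triple_permutations(2)[OF T]]
    mult_axis_span[OF axis_triple_permutations(4)[OF T]]
  by (simp_all add: monomials_permutations[where x = x and y = y and z = z])

text \<open>The recursion for longer monomials: by the product formula and closure under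
  \<open>x\<close>, three products with fewer factors \<open>x\<close> suffice.\<close>

lemma multiples_closed:
  assumes "u \<in> monomial_span x y z" "v \<in> monomial_span x y z" "u \<odot> v \<in> monomial_span x y z" "u \<odot> (x \<odot> v) \<in> monomial_span x y z" "v \<odot> (x \<odot> u) \<in> monomial_span x y z"
  shows "(x \<odot> u) \<odot> (x \<odot> v) \<in> monomial_span x y z"
proof -
  obtain f where "axis_form \<eta> x f" "\<eta> \<noteq> 0" "(2 :: 'k) \<noteq> 0"
    using T by (auto simp: axis_triple_def)
  then show ?thesis
    by (rule axis_form_mult_span) (intro subspace_span axes_closed monomials_mem assms)+
qed

lemma pair_mult_pair: "(x \<odot> y) \<odot> (x \<odot> y) \<in> monomial_span x y z" "(x \<odot> y) \<odot> (x \<odot> z) \<in> monomial_span x y z"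
proof -
  obtain g where "axis_form \<eta> y g"
    using T by (auto simp: axis_triple_def)
  then have "y \<odot> y = y" by (rule axis_formD(2))
  then show "(x \<odot> y) \<odot> (x \<odot> y) \<in> monomial_span x y z" "(x \<odot> y) \<odot> (x \<odot> z) \<in> monomial_span x y z"
    by (intro multiples_closed axes_closed monomials_mem; simp add: monomials_mem)+
qed

end

context
  fixes \<eta> x y z
  assumes T: "axis_triple \<eta> x y z"
begin

text \<open>Closing the context has generalized \<open>pair_mult_pair\<close>, which is used here
  for a permuted triple.\<close>

lemma pair_mult_adjacent: "(x \<odot> y) \<odot> (y \<odot> z) \<in> monomial_span x y z"
  using pair_mult_pair(2)[OF axis_triple_permutations(2)[OF T]]
  unfolding monomials_permutations[where x = x and y = y and z = z] mult_commute[of y x] .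

lemma pair_mult_triple: "(x \<odot> y) \<odot> (x \<odot> (y \<odot> z)) \<in> monomial_span x y z"
proof (intro multiples_closed[OF T] axes_closed[OF T] monomials_mem)
  show "(y \<odot> z) \<odot> (x \<odot> y) \<in> monomial_span x y z"
    using pair_mult_adjacent by (rule mult_mem_commute)
qed

end

context
  fixes \<eta> x y z
  assumes T: "axis_triple \<eta> x y z"
begin

lemma pair_mult_triple': "(x \<odot> y) \<odot> (y \<odot> (x \<odot> z)) \<in> monomial_span x y z"
  using pair_mult_triple[OF axis_triple_permutations(2)[OF T]]
  unfolding monomials_permutations[where x = x and y = y and z = z] mult_commute[of y x] .

lemma pair_mult_axis: "(x \<odot> y) \<odot> x \<in> monomial_span x y z" "(x \<odot> y) \<odot> y \<in> monomial_span x y z" "(x \<odot> y) \<odot> z \<in> monomial_span x y z"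
  unfolding mult_commute[of "x \<odot> y"] by (intro axes_closed[OF T] monomials_mem)+

text \<open>The second factor is not visibly a multiple of \<open>x\<close> or \<open>y\<close>;
  \<open>axis_form_swap\<close> replaces it by \<open>y \<odot> (x \<odot> z)\<close> and multiples
  of \<open>x\<close>, whose products with \<open>x \<odot> y\<close> are under control.\<close>

lemma pair_mult_opposite: "(x \<odot> y) \<odot> (z \<odot> (x \<odot> y)) \<in> monomial_span x y z"
proof -
  obtain f where f: "axis_form \<eta> x f" "\<eta> \<noteq> 0" "(2 :: 'k) \<noteq> 0"
    using T by (auto simp: axis_triple_def)
  have "(x \<odot> y) \<odot> (x \<odot> (y \<odot> (x \<odot> z))) \<in> monomial_span x y z"
  proof (intro multiples_closed[OF T] axes_closed[OF T] monomials_mem)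
    show "(y \<odot> (x \<odot> z)) \<odot> (x \<odot> y) \<in> monomial_span x y z"
      using pair_mult_triple' by (rule mult_mem_commute)
  qed
  then show ?thesis
    unfolding axis_form_swap[OF f, of z y] bilinear
    by (intro span_intros pair_mult_triple' pair_mult_triple[OF T] pair_mult_axis pair_mult_pair[OF T])
qed

lemma pair_closed:
  assumes "s \<in> monomial_span x y z"
  shows "(x \<odot> y) \<odot> s \<in> monomial_span x y z"
  using assms
  by (rule mult_monomials_span)
    (rule pair_mult_axis pair_mult_pair[OF T] pair_mult_adjacent[OF T] pair_mult_triple[OF T]
      pair_mult_triple' pair_mult_opposite)+

end

context
  fixes \<eta> x y z
  assumes T: "axis_triple \<eta> x y z"
begin

lemma pairs_closed:
  assumes "s \<in> monomial_span x y z"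
  shows "(x \<odot> y) \<odot> s \<in> monomial_span x y z" "(x \<odot> z) \<odot> s \<in> monomial_span x y z" "(y \<odot> z) \<odot> s \<in> monomial_span x y z"
  using assms pair_closed[OF T] pair_closed[OF axis_triple_permutations(1)[OF T]]
    pair_closed[OF axis_triple_permutations(3)[OF T]]
  by (simp_all add: monomials_permutations[where x = x and y = y and z = z])

lemma triple_mult_self: "(x \<odot> (y \<odot> z)) \<odot> (x \<odot> (y \<odot> z)) \<in> monomial_span x y z"
  by (intro multiples_closed[OF T] pairs_closed monomials_mem)

text \<open>Expanding the second factor along \<open>x\<close> produces the product
  \<open>(x \<odot> (y \<odot> z)) \<odot> (z \<odot> (x \<odot> y))\<close> twice, with opposite signs.\<close>

lemma triple_mult_triple: "(x \<odot> (y \<odot> z)) \<odot> (y \<odot> (x \<odot> z)) \<in> monomial_span x y z"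
proof -
  obtain f where f: "axis_form \<eta> x f" "\<eta> \<noteq> 0" "(2 :: 'k) \<noteq> 0"
    using T by (auto simp: axis_triple_def)
  let ?w = "x \<odot> (y \<odot> z)" and ?v = "z \<odot> (x \<odot> y)"
  have zy: "z \<odot> y = y \<odot> z" and vw: "?v \<odot> ?w = ?w \<odot> ?v"
    by (rule mult_commute)+
  have 1: "?w \<odot> x \<in> monomial_span x y z" "?w \<odot> (x \<odot> z) \<in> monomial_span x y z" "?w \<odot> (x \<odot> y) \<in> monomial_span x y z"
    unfolding mult_commute[of ?w] by (intro pairs_closed axes_closed[OF T] monomials_mem)+
  have "?w \<odot> (y \<odot> (x \<odot> z)) = ?w \<odot> ?w
      + (f (y \<odot> z) + 2 * (1 - 2 * \<eta>) / \<eta> * f z * f y) *\<^sub>F (?w \<odot> x) + f y *\<^sub>F (?w \<odot> (x \<odot> z)) + f z *\<^sub>F (?w \<odot> (x \<odot> y))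
      - (f ((y \<odot> z) \<odot> ?v) *\<^sub>F x + (y \<odot> z) \<odot> (x \<odot> ?v) - x \<odot> ((y \<odot> z) \<odot> ?v) + f ?v *\<^sub>F ?w
        + f (y \<odot> z) *\<^sub>F (x \<odot> ?v)) - (2 * (1 - 2 * \<eta>) / \<eta> * f (y \<odot> z) * f ?v) *\<^sub>F x"
    unfolding axis_form_swap[OF f, of y z] zy bilinear axis_form_mult_mult[OF f, of "y \<odot> z" ?v] vw
    by (rule eq_by_functionals) (use f(2,3) in \<open>simp (no_asm_simp) add: field_simps\<close>)
  also have "\<dots> \<in> monomial_span x y z"
    by (intro span_intros triple_mult_self 1 pairs_closed axes_closed[OF T] monomials_mem)
  finally show ?thesis .
qed

end

context
  fixes \<eta> x y z
  assumes T: "axis_triple \<eta> x y z"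
begin

lemma triple_closed:
  assumes "s \<in> monomial_span x y z"
  shows "(x \<odot> (y \<odot> z)) \<odot> s \<in> monomial_span x y z"
proof -
  have "(x \<odot> (y \<odot> z)) \<odot> (z \<odot> (x \<odot> y)) \<in> monomial_span x y z"
    using triple_mult_triple[OF axis_triple_permutations(1)[OF T]]
    unfolding monomials_permutations[where x = x and y = y and z = z] mult_commute[of z y] .
  then show ?thesis
    by (intro mult_monomials_span[OF assms] triple_mult_self[OF T] triple_mult_triple[OF T]
        axes_closed[OF T monomials_mem(7), THEN mult_mem_commute]
        pairs_closed[OF T monomials_mem(7), THEN mult_mem_commute])
qed

end

lemma monomials_subalgebra:
  assumes T: "axis_triple \<eta> x y z"
  shows "subalgebra (monomial_span x y z)"
  unfolding subalgebra_def
proof (intro conjI ballI)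
  show "subspace (monomial_span x y z)" by (rule subspace_span)
  fix s t assume s: "s \<in> monomial_span x y z" and t: "t \<in> monomial_span x y z"
  note triples = triple_closed[OF T]
    triple_closed[OF axis_triple_permutations(2)[OF T],
      unfolded monomials_permutations[where x = x and y = y and z = z]]
    triple_closed[OF axis_triple_permutations(4)[OF T],
      unfolded monomials_permutations[where x = x and y = y and z = z]]
  have "t \<odot> s \<in> monomial_span x y z"
    by (intro mult_monomials_span[OF s] axes_closed[OF T t, THEN mult_mem_commute]
        pairs_closed[OF T t, THEN mult_mem_commute] triples[OF t, THEN mult_mem_commute])
  then show "s \<odot> t \<in> monomial_span x y z"
    by (rule mult_mem_commute)
qed

subsection \<open>The multiplication table\<close>

text \<open>At \<open>\<eta> = 1/2\<close> the coefficient \<open>1 - 2 * \<eta>\<close> in the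
  product formula vanishes.\<close>

lemma axis_form_half:
  assumes two: "(2 :: 'k) \<noteq> 0" and a: "axis_form (1/2) a f"
  shows axis_form_half_square: "a \<odot> (a \<odot> x) = (1/2) *\<^sub>F (f x *\<^sub>F a + a \<odot> x)"
    and axis_form_half_mult: "(a \<odot> x) \<odot> (a \<odot> y) = (1/4) *\<^sub>F (f (x \<odot> y) *\<^sub>F a + x \<odot> (a \<odot> y) + y \<odot> (a \<odot> x)
      - a \<odot> (x \<odot> y) + f y *\<^sub>F (a \<odot> x) + f x *\<^sub>F (a \<odot> y))"
    and axis_form_half_nested: "a \<odot> (x \<odot> (a \<odot> y)) = (1/4) *\<^sub>F (f (x \<odot> y) *\<^sub>F a + x \<odot> (a \<odot> y)
      - y \<odot> (a \<odot> x) + a \<odot> (x \<odot> y) + f y *\<^sub>F (a \<odot> x) + f x *\<^sub>F (a \<odot> y))"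
    and axis_form_half_form: "f (x \<odot> (a \<odot> y)) = (f (x \<odot> y) + f x * f y) / 2"
proof -
  note [simp] = two numeral_Bit0_eq_0[OF two]
  note D = axis_formD[OF a]
  note n = half_neq_0[OF two] half_neq_1[OF two]
  show "a \<odot> (a \<odot> x) = (1/2) *\<^sub>F (f x *\<^sub>F a + a \<odot> x)"
    unfolding D(3) by (rule eq_by_functionals) (simp (no_asm_simp) add: field_simps)
  show m: "(a \<odot> x) \<odot> (a \<odot> y) = (1/4) *\<^sub>F (f (x \<odot> y) *\<^sub>F a + x \<odot> (a \<odot> y) + y \<odot> (a \<odot> x)
      - a \<odot> (x \<odot> y) + f y *\<^sub>F (a \<odot> x) + f x *\<^sub>F (a \<odot> y))"
    unfolding axis_form_mult_mult[OF a n(1) two]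
    by (rule eq_by_functionals) (simp (no_asm_simp) add: field_simps)
  show "a \<odot> (x \<odot> (a \<odot> y)) = (1/4) *\<^sub>F (f (x \<odot> y) *\<^sub>F a + x \<odot> (a \<odot> y)
      - y \<odot> (a \<odot> x) + a \<odot> (x \<odot> y) + f y *\<^sub>F (a \<odot> x) + f x *\<^sub>F (a \<odot> y))"
    unfolding D(5) m
    by (rule eq_by_functionals) (simp (no_asm_simp) add: field_simps)
  show "f (x \<odot> (a \<odot> y)) = (f (x \<odot> y) + f x * f y) / 2"
    unfolding axis_form_mult_nested[OF a n two] by (simp add: field_simps)
qed

text \<open>The scalars \<open>p\<close>, \<open>q\<close>, \<open>r\<close> belong to the pairs
  \<open>xy\<close>, \<open>yz\<close>, \<open>xz\<close> and \<open>s\<close> to the triple. A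
  permutation of the axes thus only permutes the arguments, and each entry of the table is proved
  for one ordering.\<close>

definition half_triple ::
  "'v \<Rightarrow> 'v \<Rightarrow> 'v \<Rightarrow> ('v \<Rightarrow> 'k) \<Rightarrow> ('v \<Rightarrow> 'k) \<Rightarrow> ('v \<Rightarrow> 'k) \<Rightarrow> 'k \<Rightarrow> 'k \<Rightarrow> 'k \<Rightarrow> 'k \<Rightarrow> bool" where
  "half_triple x y z f g h p q r s \<longleftrightarrow> (2 :: 'k) \<noteq> 0 \<and>
     axis_form (1/2) x f \<and> axis_form (1/2) y g \<and> axis_form (1/2) z h \<and>
     f y = p \<and> g x = p \<and> g z = q \<and> h y = q \<and> f z = r \<and> h x = r \<and>
     f (y \<odot> z) = s \<and> g (x \<odot> z) = s \<and> h (x \<odot> y) = s"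

lemma half_tripleI:
  assumes two: "(2 :: 'k) \<noteq> 0" and x: "axis_form (1/2) x f" and y: "axis_form (1/2) y g"
    and z: "axis_form (1/2) z h"
  shows "half_triple x y z f g h (f y) (g z) (h x) (f (y \<odot> z))"
proof -
  have "f (y \<odot> z) = h (x \<odot> y)"
    using axis_form_half_sym3[OF two x z y] mult_commute by simp
  then show ?thesis
    unfolding half_triple_def
    using two x y z axis_form_half_sym[OF two x y] axis_form_half_sym[OF two y z]
      axis_form_half_sym[OF two x z] axis_form_half_sym3[OF two x y z] by (intro conjI) simp_all
qed

text \<open>These two transpositions generate all permutations.\<close>

lemma half_triple_swap:
  assumes "half_triple x y z f g h p q r s"
  shows "half_triple y x z g f h p r q s" and "half_triple x z y f h g r q p s"
  using assms by (simp_all add: half_triple_def mult_commute[of y x] mult_commute[of z y])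

lemma half_triple_permutations:
  assumes "half_triple x y z f g h p q r s"
  shows "half_triple x z y f h g r q p s" "half_triple y x z g f h p r q s"
    "half_triple y z x g h f q r p s" "half_triple z x y h f g r p q s"
    "half_triple z y x h g f q p r s"
  using assms half_triple_swap by blast+

lemma half_tripleD:
  assumes "half_triple x y z f g h p q r s"
  shows "(2 :: 'k) \<noteq> 0" "axis_form (1/2) x f"
    and half_triple_values: "f y = p" "f z = r" "f (y \<odot> z) = s"
    "f (x \<odot> w) = f w" "f x = 1" "f (v + w) = f v + f w" "f (v - w) = f v - f w" "f (t *\<^sub>F w) = t * f w"
    "f (v \<odot> (x \<odot> w)) = (f (v \<odot> w) + f v * f w) / 2"
proof -
  show two: "(2 :: 'k) \<noteq> 0" and x: "axis_form (1/2) x f"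
    and "f y = p" "f z = r" "f (y \<odot> z) = s"
    using assms by (simp_all add: half_triple_def)
  note L = axis_form_linear[OF x half_neq_1[OF two]]
  show "f (x \<odot> w) = f w" "f x = 1" "f (v + w) = f v + f w" "f (v - w) = f v - f w"
    "f (t *\<^sub>F w) = t * f w"
    by (rule L)+
  show "f (v \<odot> (x \<odot> w)) = (f (v \<odot> w) + f v * f w) / 2"
    by (rule axis_form_half_form[OF two x])
qed

context
  fixes x y z f g h p q r s
  assumes T: "half_triple x y z f g h p q r s"
begin

lemmas half_triple_simps = half_tripleD(1)[OF T] numeral_Bit0_eq_0[OF half_tripleD(1)[OF T]]

lemma half_table_1: "x \<odot> x = x"
  using axis_formD(2)[OF half_tripleD(2)[OF T]] .

lemma half_table_2: "x \<odot> (x \<odot> y) = (1/2) *\<^sub>F (p *\<^sub>F x + x \<odot> y)"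
  and half_table_3: "x \<odot> (x \<odot> (y \<odot> z)) = (1/2) *\<^sub>F (s *\<^sub>F x + x \<odot> (y \<odot> z))"
  by (simp_all only: axis_form_half_square[OF half_tripleD(1,2)[OF T]] half_triple_values[OF T])

lemma half_table_4: "x \<odot> (y \<odot> (x \<odot> z)) =
    (1/4) *\<^sub>F (s *\<^sub>F x + r *\<^sub>F (x \<odot> y) + p *\<^sub>F (x \<odot> z) + x \<odot> (y \<odot> z) + y \<odot> (x \<odot> z) - z \<odot> (x \<odot> y))"
  unfolding axis_form_half_nested[OF half_tripleD(1,2)[OF T]] half_triple_values[OF T]
  by (simp add: algebra_simps)

lemma half_table_6: "(x \<odot> y) \<odot> (x \<odot> z) =
    (1/4) *\<^sub>F (s *\<^sub>F x + r *\<^sub>F (x \<odot> y) + p *\<^sub>F (x \<odot> z) - x \<odot> (y \<odot> z) + y \<odot> (x \<odot> z) + z \<odot> (x \<odot> y))"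
  unfolding axis_form_half_mult[OF half_tripleD(1,2)[OF T]] half_triple_values[OF T]
  by (simp add: algebra_simps)

end

context
  fixes x y z f g h p q r s
  assumes T: "half_triple x y z f g h p q r s"
begin

lemmas canonical_pairs = mult_commute[of y x] mult_commute[of z x] mult_commute[of z y]

lemma half_table_5: "(x \<odot> y) \<odot> (x \<odot> y) = (p/4) *\<^sub>F (x + y) + (p/2) *\<^sub>F (x \<odot> y)"
proof -
  note [simp] = half_triple_simps[OF T]
  note y = half_triple_permutations(2)[OF T]
  show ?thesis
    unfolding axis_form_half_mult[OF half_tripleD(1,2)[OF T]] half_triple_values[OF T]
      half_table_1[OF y] half_table_2[OF y, unfolded canonical_pairs] bilinear
    by (rule eq_by_functionals) (simp (no_asm_simp) add: half_triple_values[OF T] field_simps)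
qed

text \<open>Products of an axis with any monomial, for all orderings; \<open>canonical_pairs\<close>
  makes every entry refer to the same nine monomials.\<close>

lemmas half_rows = half_triple_permutations[OF T, THEN half_table_2, unfolded canonical_pairs]
  half_triple_permutations[OF T, THEN half_table_3, unfolded canonical_pairs]
  half_triple_permutations[OF T, THEN half_table_4, unfolded canonical_pairs]
  half_triple_permutations[OF T, THEN half_table_1]
  half_table_1[OF T] half_table_2[OF T] half_table_3[OF T] half_table_4[OF T]

text \<open>In the product formula for \<open>x\<close> with \<open>y\<close> and
  \<open>y \<odot> z\<close>, the only product not by an axis is
  \<open>(x \<odot> y) \<odot> (y \<odot> z)\<close>, the sixth formula with \<open>y\<close> in
  front.\<close>

lemma half_table_7: "(x \<odot> y) \<odot> (x \<odot> (y \<odot> z)) = (1/8) *\<^sub>F ((p * q + s) *\<^sub>F x + s *\<^sub>F y + (2 * s) *\<^sub>F (x \<odot> y)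
    + p *\<^sub>F (y \<odot> z) + (2 * p) *\<^sub>F (x \<odot> (y \<odot> z)))"
proof -
  note [simp] = half_triple_simps[OF T]
  have yz_xy: "(y \<odot> z) \<odot> (x \<odot> y) = (x \<odot> y) \<odot> (y \<odot> z)" by (rule mult_commute)
  show ?thesis
    unfolding axis_form_half_mult[OF half_tripleD(1,2)[OF T]] half_rows bilinear canonical_pairs yz_xy
      half_triple_permutations(2)[OF T, THEN half_table_6, unfolded canonical_pairs]
      half_triple_values[OF T]
    by (rule eq_by_functionals) (simp (no_asm_simp) add: field_simps)
qed

end

context
  fixes x y z f g h p q r s
  assumes T: "half_triple x y z f g h p q r s"
begin

text \<open>A fresh copy for the fixed axes: the equations of the closed context have become
  schematic and would commute arbitrary factors.\<close>

lemmas canonical_order = mult_commute[of y x] mult_commute[of z x] mult_commute[of z y]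

lemmas half_mult_x = axis_form_half_mult[OF half_tripleD(1,2)[OF T]]

lemmas half_pairs = half_triple_permutations[OF T, THEN half_table_5, unfolded canonical_order]
  half_triple_permutations[OF T, THEN half_table_6, unfolded canonical_order]
  half_triple_permutations[OF T, THEN half_table_7, unfolded canonical_order]
  half_table_5[OF T] half_table_6[OF T] half_table_7[OF T]

text \<open>The fourth formula of the table expresses \<open>z \<odot> (x \<odot> y)\<close> by \<open>x \<odot> (y \<odot> (x \<odot> z))\<close>, whose product
  with \<open>x \<odot> y\<close> is known.\<close>

lemma half_table_8: "(x \<odot> y) \<odot> (z \<odot> (x \<odot> y)) = (1/8) *\<^sub>F ((p * q) *\<^sub>F x + (p * r) *\<^sub>F y
    + (4 * s) *\<^sub>F (x \<odot> y) + p *\<^sub>F (y \<odot> z) + p *\<^sub>F (x \<odot> z) - (2 * p) *\<^sub>F (x \<odot> (y \<odot> z))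
    - (2 * p) *\<^sub>F (y \<odot> (x \<odot> z)) + (4 * p) *\<^sub>F (z \<odot> (x \<odot> y)))"
proof -
  note [simp] = half_triple_simps[OF T]
  have z_xy: "z \<odot> (x \<odot> y) = s *\<^sub>F x + r *\<^sub>F (x \<odot> y) + p *\<^sub>F (x \<odot> z) + x \<odot> (y \<odot> z) + y \<odot> (x \<odot> z)
    - 4 *\<^sub>F (x \<odot> (y \<odot> (x \<odot> z)))"
    unfolding half_table_4[OF T] by (rule eq_by_functionals) (simp (no_asm_simp) add: field_simps)
  have comm: "(x \<odot> y) \<odot> x = x \<odot> (x \<odot> y)" "(y \<odot> (x \<odot> z)) \<odot> (x \<odot> y) = (x \<odot> y) \<odot> (y \<odot> (x \<odot> z))"
    by (rule mult_commute)+
  have "(x \<odot> y) \<odot> (z \<odot> (x \<odot> y)) = s *\<^sub>F ((x \<odot> y) \<odot> x) + r *\<^sub>F ((x \<odot> y) \<odot> (x \<odot> y)) + p *\<^sub>F ((x \<odot> y) \<odot> (x \<odot> z))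
     + (x \<odot> y) \<odot> (x \<odot> (y \<odot> z)) + (x \<odot> y) \<odot> (y \<odot> (x \<odot> z)) - 4 *\<^sub>F ((x \<odot> y) \<odot> (x \<odot> (y \<odot> (x \<odot> z))))"
    by (subst z_xy) (simp only: bilinear)
  then show ?thesis
    \<comment> \<open>This comes before the other rules, since the fourth formula would rewrite the
      second factor and bring back \<open>z \<odot> (x \<odot> y)\<close>.\<close>
    unfolding half_mult_x[of y "y \<odot> (x \<odot> z)"]
    unfolding half_rows[OF T] canonical_order comm bilinear half_pairs half_triple_values[OF T]
    by (rule trans) (rule eq_by_functionals, simp (no_asm_simp) add: field_simps)
qed

end

context
  fixes x y z f g h p q r s
  assumes T: "half_triple x y z f g h p q r s"
begin

lemmas canonical_factors = mult_commute[of y x] mult_commute[of z x] mult_commute[of z y]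

lemmas half_triples = half_triple_permutations[OF T, THEN half_table_8, unfolded canonical_factors] half_table_8[OF T]

text \<open>The product formula for \<open>x\<close> leads to the square of
  \<open>y \<odot> z\<close> and to its product with \<open>x \<odot> (y \<odot> z)\<close>, an
  instance of the eighth formula.\<close>

lemma half_table_9: "(x \<odot> (y \<odot> z)) \<odot> (x \<odot> (y \<odot> z)) = (1/16) *\<^sub>F ((q * (p + r + 2 * s)) *\<^sub>F x
    + (q * r) *\<^sub>F y + (q * p) *\<^sub>F z + (4 * s) *\<^sub>F (y \<odot> z) + (2 * q + 8 * s) *\<^sub>F (x \<odot> (y \<odot> z))
    - (2 * q) *\<^sub>F (y \<odot> (x \<odot> z)) - (2 * q) *\<^sub>F (z \<odot> (x \<odot> y)))"
proof -
  note [simp] = half_triple_simps[OF T]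
  show ?thesis
    unfolding half_mult_x[OF T]
    unfolding half_rows[OF T] canonical_factors bilinear half_pairs[OF T] half_triples half_triple_values[OF T]
    by (rule eq_by_functionals) (simp (no_asm_simp) add: field_simps)
qed

text \<open>As in \<open>triple_mult_triple\<close>, the product \<open>(x \<odot> (y \<odot> z)) \<odot> (z \<odot> (x \<odot> y))\<close>, not computed so far,
  cancels.\<close>

lemma half_table_10: "(x \<odot> (y \<odot> z)) \<odot> (y \<odot> (x \<odot> z)) = (1/16) *\<^sub>F ((q * (r + s)) *\<^sub>F x
    + (r * (q + s)) *\<^sub>F y + (p * s) *\<^sub>F z + (2 * s) *\<^sub>F (x \<odot> y) + (2 * (p * r + s)) *\<^sub>F (y \<odot> z)
    + (2 * (p * q + s)) *\<^sub>F (x \<odot> z) + (4 * s - p + q - r) *\<^sub>F (x \<odot> (y \<odot> z))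
    + (4 * s - p - q + r) *\<^sub>F (y \<odot> (x \<odot> z)) + (p - q - r - 4 * s) *\<^sub>F (z \<odot> (x \<odot> y)))"
proof -
  note [simp] = half_triple_simps[OF T]
  have y_xz: "y \<odot> (x \<odot> z) = s *\<^sub>F x + p *\<^sub>F (x \<odot> z) + r *\<^sub>F (x \<odot> y) + x \<odot> (y \<odot> z) + z \<odot> (x \<odot> y)
    - 4 *\<^sub>F (x \<odot> (z \<odot> (x \<odot> y)))"
    unfolding half_rows[OF T] canonical_factors by (rule eq_by_functionals) (simp (no_asm_simp) add: field_simps)
  have comm: "(x \<odot> (y \<odot> z)) \<odot> x = x \<odot> (x \<odot> (y \<odot> z))"
    "(x \<odot> (y \<odot> z)) \<odot> (x \<odot> y) = (x \<odot> y) \<odot> (x \<odot> (y \<odot> z))"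
    "(x \<odot> (y \<odot> z)) \<odot> (x \<odot> z) = (x \<odot> z) \<odot> (x \<odot> (y \<odot> z))"
    "(z \<odot> (x \<odot> y)) \<odot> (x \<odot> (y \<odot> z)) = (x \<odot> (y \<odot> z)) \<odot> (z \<odot> (x \<odot> y))"
    "(y \<odot> z) \<odot> x = x \<odot> (y \<odot> z)"
    by (rule mult_commute)+
  have "(x \<odot> (y \<odot> z)) \<odot> (y \<odot> (x \<odot> z)) = s *\<^sub>F ((x \<odot> (y \<odot> z)) \<odot> x) + p *\<^sub>F ((x \<odot> (y \<odot> z)) \<odot> (x \<odot> z))
     + r *\<^sub>F ((x \<odot> (y \<odot> z)) \<odot> (x \<odot> y)) + (x \<odot> (y \<odot> z)) \<odot> (x \<odot> (y \<odot> z))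
     + (x \<odot> (y \<odot> z)) \<odot> (z \<odot> (x \<odot> y)) - 4 *\<^sub>F ((x \<odot> (y \<odot> z)) \<odot> (x \<odot> (z \<odot> (x \<odot> y))))"
    by (subst y_xz) (simp only: bilinear)
  then show ?thesis
    \<comment> \<open>Again before the fourth formula can expand
      \<open>x \<odot> (z \<odot> (x \<odot> y))\<close>.\<close>
    unfolding half_mult_x[OF T, of "y \<odot> z" "z \<odot> (x \<odot> y)"]
    unfolding half_rows[OF T] canonical_factors comm bilinear half_pairs[OF T] half_triples half_table_9
      half_triple_values[OF T]
    by (rule trans) (rule eq_by_functionals, simp (no_asm_simp) add: field_simps)
qed

end

lemma half_table:
  assumes T: "half_triple x y z f g h l_xy l_yz l_xz \<psi>"
  shows "let xy = x \<odot> y; xz = x \<odot> z; yz = y \<odot> z;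
          x_yz = x \<odot> yz; y_xz = y \<odot> xz; z_xy = z \<odot> xy
      in
        x \<odot> x = x \<and> x \<odot> y = xy \<and> x \<odot> yz = x_yz \<and>
        x \<odot> xy = (1/2) *\<^sub>F (l_xy *\<^sub>F x + xy) \<and>
        x \<odot> x_yz = (1/2) *\<^sub>F (\<psi> *\<^sub>F x + x_yz) \<and>
        x \<odot> y_xz = (1/4) *\<^sub>F (\<psi> *\<^sub>F x + l_xz *\<^sub>F xy + l_xy *\<^sub>F xz + x_yz + y_xz - z_xy) \<and>
        xy \<odot> xy = (l_xy/4) *\<^sub>F (x + y) + (l_xy/2) *\<^sub>F xy \<and>
        xy \<odot> xz = (1/4) *\<^sub>F (\<psi> *\<^sub>F x + l_xz *\<^sub>F xy + l_xy *\<^sub>F xz - x_yz + y_xz + z_xy) \<and>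
        xy \<odot> x_yz = (1/8) *\<^sub>F ((l_xy * l_yz + \<psi>) *\<^sub>F x + \<psi> *\<^sub>F y + (2 * \<psi>) *\<^sub>F xy
           + l_xy *\<^sub>F yz + (2 * l_xy) *\<^sub>F x_yz) \<and>
        xy \<odot> z_xy = (1/8) *\<^sub>F ((l_xy * l_yz) *\<^sub>F x + (l_xy * l_xz) *\<^sub>F y + (4 * \<psi>) *\<^sub>F xy
           + l_xy *\<^sub>F yz + l_xy *\<^sub>F xz - (2 * l_xy) *\<^sub>F x_yz - (2 * l_xy) *\<^sub>F y_xz
           + (4 * l_xy) *\<^sub>F z_xy) \<and>
        x_yz \<odot> x_yz = (1/16) *\<^sub>F ((l_yz * (l_xy + l_xz + 2 * \<psi>)) *\<^sub>F x + (l_yz * l_xz) *\<^sub>F y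
           + (l_yz * l_xy) *\<^sub>F z + (4 * \<psi>) *\<^sub>F yz + (2 * l_yz + 8 * \<psi>) *\<^sub>F x_yz
           - (2 * l_yz) *\<^sub>F y_xz - (2 * l_yz) *\<^sub>F z_xy) \<and>
        x_yz \<odot> y_xz = (1/16) *\<^sub>F ((l_yz * (l_xz + \<psi>)) *\<^sub>F x + (l_xz * (l_yz + \<psi>)) *\<^sub>F y
           + (l_xy * \<psi>) *\<^sub>F z + (2 * \<psi>) *\<^sub>F xy + (2 * (l_xy * l_xz + \<psi>)) *\<^sub>F yz
           + (2 * (l_xy * l_yz + \<psi>)) *\<^sub>F xz
           + (4 * \<psi> - l_xy + l_yz - l_xz) *\<^sub>F x_yz
           + (4 * \<psi> - l_xy - l_yz + l_xz) *\<^sub>F y_xz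
           + (l_xy - l_yz - l_xz - 4 * \<psi>) *\<^sub>F z_xy)"
  unfolding Let_def
  by (intro conjI refl half_table_1[OF T] half_table_2[OF T] half_table_3[OF T] half_table_4[OF T]
      half_table_5[OF T] half_table_6[OF T] half_table_7[OF T] half_table_8[OF T] half_table_9[OF T]
      half_table_10[OF T])

end

section \<open>Application to the generators \<open>a\<close>, \<open>b\<close>,
  \<open>c\<close>\<close>

theorem proposition2:
  fixes scale :: "'k::field \<Rightarrow> 'v::ab_group_add \<Rightarrow> 'v"  (infixr \<open>*\<^sub>F\<close> 76)
    and mult :: "'v \<Rightarrow> 'v \<Rightarrow> 'v"  (infixl \<open>\<odot>\<close> 75)
    and \<eta> \<alpha> \<beta> \<gamma> \<psi> :: 'k and a b c :: 'v
  assumes char: "CHAR('k) \<noteq> 2"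
    and eta: "\<eta> \<noteq> 0" "\<eta> \<noteq> 1"
    and axial: "axial_algebra_jordan_type scale mult \<eta> {a, b, c}"
    and prim: "\<forall>x\<in>{a, b, c}. comm_nonassoc_algebra.primitive scale mult x"
    and alpha: "\<alpha> = comm_nonassoc_algebra.\<phi> scale mult \<eta> a b"
    and beta: "\<beta> = comm_nonassoc_algebra.\<phi> scale mult \<eta> b c"
    and gamma: "\<gamma> = comm_nonassoc_algebra.\<phi> scale mult \<eta> c a"
    and psi: "\<psi> = comm_nonassoc_algebra.\<phi> scale mult \<eta> a (b \<odot> c)"
  shows
    "module.span scale
       {a, b, c, a \<odot> b, a \<odot> c, b \<odot> c, (a \<odot> b) \<odot> c, (a \<odot> c) \<odot> b, (b \<odot> c) \<odot> a} = UNIV \<and>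
     (\<eta> = 1/2 \<longrightarrow>
       (\<forall>(x, y, z, l_xy, l_yz, l_xz) \<in>
          {(a, b, c, \<alpha>, \<beta>, \<gamma>), (a, c, b, \<gamma>, \<beta>, \<alpha>), (b, a, c, \<alpha>, \<gamma>, \<beta>),
           (b, c, a, \<beta>, \<gamma>, \<alpha>), (c, a, b, \<gamma>, \<alpha>, \<beta>), (c, b, a, \<beta>, \<alpha>, \<gamma>)}.
        let xy = x \<odot> y; xz = x \<odot> z; yz = y \<odot> z;
            x_yz = x \<odot> yz; y_xz = y \<odot> xz; z_xy = z \<odot> xy
        in
          x \<odot> x = x \<and> x \<odot> y = xy \<and> x \<odot> yz = x_yz \<and>
          x \<odot> xy = (1/2) *\<^sub>F (l_xy *\<^sub>F x + xy) \<and>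
          x \<odot> x_yz = (1/2) *\<^sub>F (\<psi> *\<^sub>F x + x_yz) \<and>
          x \<odot> y_xz = (1/4) *\<^sub>F (\<psi> *\<^sub>F x + l_xz *\<^sub>F xy + l_xy *\<^sub>F xz + x_yz + y_xz - z_xy) \<and>
          xy \<odot> xy = (l_xy/4) *\<^sub>F (x + y) + (l_xy/2) *\<^sub>F xy \<and>
          xy \<odot> xz = (1/4) *\<^sub>F (\<psi> *\<^sub>F x + l_xz *\<^sub>F xy + l_xy *\<^sub>F xz - x_yz + y_xz + z_xy) \<and>
          xy \<odot> x_yz = (1/8) *\<^sub>F ((l_xy * l_yz + \<psi>) *\<^sub>F x + \<psi> *\<^sub>F y + (2 * \<psi>) *\<^sub>F xy
             + l_xy *\<^sub>F yz + (2 * l_xy) *\<^sub>F x_yz) \<and>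
          xy \<odot> z_xy = (1/8) *\<^sub>F ((l_xy * l_yz) *\<^sub>F x + (l_xy * l_xz) *\<^sub>F y + (4 * \<psi>) *\<^sub>F xy
             + l_xy *\<^sub>F yz + l_xy *\<^sub>F xz - (2 * l_xy) *\<^sub>F x_yz - (2 * l_xy) *\<^sub>F y_xz
             + (4 * l_xy) *\<^sub>F z_xy) \<and>
          x_yz \<odot> x_yz = (1/16) *\<^sub>F ((l_yz * (l_xy + l_xz + 2 * \<psi>)) *\<^sub>F x + (l_yz * l_xz) *\<^sub>F y
             + (l_yz * l_xy) *\<^sub>F z + (4 * \<psi>) *\<^sub>F yz + (2 * l_yz + 8 * \<psi>) *\<^sub>F x_yz
             - (2 * l_yz) *\<^sub>F y_xz - (2 * l_yz) *\<^sub>F z_xy) \<and>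
          x_yz \<odot> y_xz = (1/16) *\<^sub>F ((l_yz * (l_xz + \<psi>)) *\<^sub>F x + (l_xz * (l_yz + \<psi>)) *\<^sub>F y
             + (l_xy * \<psi>) *\<^sub>F z + (2 * \<psi>) *\<^sub>F xy + (2 * (l_xy * l_xz + \<psi>)) *\<^sub>F yz
             + (2 * (l_xy * l_yz + \<psi>)) *\<^sub>F xz
             + (4 * \<psi> - l_xy + l_yz - l_xz) *\<^sub>F x_yz
             + (4 * \<psi> - l_xy - l_yz + l_xz) *\<^sub>F y_xz
             + (l_xy - l_yz - l_xz - 4 * \<psi>) *\<^sub>F z_xy)))"
proof -
  interpret axial_algebra_jordan_type scale mult \<eta> "{a, b, c}"
    by (fact axial)
  have two: "(2 :: 'k) \<noteq> 0"
  proof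
    assume "(2 :: 'k) = 0"
    \<comment> \<open>A divisor of 2 is 1 or 2; a field does not have characteristic 1.\<close>
    then have "CHAR('k) dvd 2"
      using of_nat_eq_0_iff_char_dvd[where 'a = 'k, of 2] by simp
    with char show False
      using CHAR_not_1[where 'a = 'k] two_is_prime_nat by (auto simp: prime_nat_iff)
  qed
  have ax: "axis_form \<eta> x (\<phi> \<eta> x)" if "x \<in> {a, b, c}" for x
    using axis_form_\<phi>[OF eta axes[OF that]] prim that by blast
  have "axis_triple \<eta> a b c"
    unfolding axis_triple_def using two eta(1) ax by blast
  then have "subalgebra (monomial_span a b c)"
    by (rule monomials_subalgebra)
  \<comment> \<open>The span is a subalgebra containing the generators, hence the whole
    algebra.\<close>
  then have "subalgebra hull {a, b, c} \<subseteq> monomial_span a b c"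
    by (intro hull_minimal) (simp_all add: monomials_mem)
  then have span: "monomial_span a b c = UNIV"
    unfolding generated by blast
  have monomials: "{a, b, c, a \<odot> b, a \<odot> c, b \<odot> c, (a \<odot> b) \<odot> c, (a \<odot> c) \<odot> b, (b \<odot> c) \<odot> a} = monomials a b c"
    unfolding monomials_def mult_commute[of "b \<odot> c" a] mult_commute[of "a \<odot> c" b] mult_commute[of "a \<odot> b" c]
    by auto
  have T: "half_triple a b c (\<phi> \<eta> a) (\<phi> \<eta> b) (\<phi> \<eta> c) \<alpha> \<beta> \<gamma> \<psi>" if half: "\<eta> = 1/2"
    unfolding alpha beta gamma psi
    by (rule half_tripleI[OF two]) (simp_all only: half[symmetric] ax insert_iff simp_thms)
  show ?thesis
    unfolding monomials span ball_simps prod.case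
    \<comment> \<open>The given ordering and its five permutations match the six tuples, scalars
      included.\<close>
    by (intro conjI impI refl TrueI half_table[OF T] half_triple_permutations[OF T, THEN half_table])
qed

end
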